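(* Let $d\ge 1$ and let $\mathbf X=(X_t)_{t\ge 0}$ be an isotropic Lévy process in $\mathbb R^d$ with Lévy–Khintchine exponent $\psi$. If $\psi\in\mathcal R^\infty_\alpha$ for some $\alpha\in[0,2)$, then $$\lim_{\substack{r\to+\infty\\ t\psi(r)\to0}}\frac{\mathbb P(|X_t|\ge r^{-1})}{t\,\psi(r)}=\mathcal C_{d,\alpha},\qquad\text{where}\qquad \mathcal C_{d,\alpha}=2^\alpha\frac{\Gamma((d+\alpha)/2)}{\Gamma(d/2)\,\Gamma(1-\alpha/2)}.$$
   Context: An isotropic Lévy process in $\mathbb R^d$ is a Lévy process $\mathbf X=(X_t)_{t\ge0}$ with $X_0=0$ a.s. such that each $X_t$ has a rotationally invariant distribution $p(t,dx)$. Its Lévy–Khintchine exponent $\psi$ is defined by $\int_{\mathbb R^d}e^{i\langle\xi,x\rangle}p(t,dx)=e^{-t\psi(\xi)}$, with $\psi(\xi)=\int_{\mathbb R^d}(1-\cos\langle\xi,x\rangle)\,\nu(dx)+\eta|\xi|^2$, where $\eta\ge0$ and $\nu$ is a rotationally invariant Lévy measure. The function $\psi$ is radial and one writes $\psi(r)=\psi(\xi)$ for $r=|\xi|$. Regular variation: a function $f$, positive on some $[x_0,+\infty)$ with $x_0>0$, is in $\mathcal R^\infty_\alpha$ (regularly varying of index $\alpha$ at infinity) if $f(\lambda x)/f(x)\to\lambda^\alpha$ as $x\to+\infty$ for each $\lambda>0$. The condition $\psi\in\mathcal R^\infty_\alpha$ refers to $r\mapsto\psi(r)$. The joint limit means: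 for every $\varepsilon>0$ there is $\delta>0$ such that the quotient is within $\varepsilon$ of the limit for all $t>0$ and all $r\ge\delta^{-1}$ with $t\psi(r)\le\delta$. *)

theory Defs
  imports "HOL-Probability.Probability"
begin

text \<open>
  Time is modelled by real numbers; only the values of the process at times \<open>t \<ge> 0\<close> are constrained.
  Right-continuity of the paths is not part of the definition, only continuity in probability.
\<close>

locale levy_process = prob_space M
  for M :: "'w measure" and X :: "real \<Rightarrow> 'w \<Rightarrow> 'a :: euclidean_space" +
  assumes measurable_at [measurable]: "t \<ge> 0 \<Longrightarrow> X t \<in> borel_measurable M"
    and start: "AE \<omega> in M. X 0 \<omega> = 0"
    and independent_increments:
      "\<And>(s :: nat \<Rightarrow> real) n. 0 \<le> s 0 \<Longrightarrow> (\<And>i. i < n \<Longrightarrow> s i < s (Suc i)) \<Longrightarrow>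
         indep_vars (\<lambda>_. borel) (\<lambda>i \<omega>. X (s (Suc i)) \<omega> - X (s i) \<omega>) {..<n}"
    and stationary_increments:
      "\<And>s t. 0 \<le> s \<Longrightarrow> s \<le> t \<Longrightarrow>
         distr M borel (\<lambda>\<omega>. X t \<omega> - X s \<omega>) = distr M borel (X (t - s))"
    and stochastically_continuous:
      "\<And>t \<epsilon>. 0 \<le> t \<Longrightarrow> 0 < \<epsilon> \<Longrightarrow>
         ((\<lambda>s. \<P>(\<omega> in M. norm (X s \<omega> - X t \<omega>) \<ge> \<epsilon>)) \<longlongrightarrow> 0) (at t within {0..})"

text \<open>
  Invariance is under the full orthogonal group, so that in dimension one it means symmetry.
\<close>

definition rotation_invariant :: "'a :: euclidean_space measure \<Rightarrow> bool" where
  "rotation_invariant \<mu> \<longleftrightarrow> (\<forall>T. orthogonal_transformation T \<longrightarrow> distr \<mu> borel T = \<mu>)"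

locale isotropic_levy_process = levy_process M X
  for M :: "'w measure" and X :: "real \<Rightarrow> 'w \<Rightarrow> 'a :: euclidean_space" +
  assumes isotropic: "t \<ge> 0 \<Longrightarrow> rotation_invariant (distr M borel (X t))"

text \<open>
  The exponent of an isotropic process is real-valued, since its laws are symmetric; a real-valued
  \<open>\<psi>\<close> with the property below is unique, and it automatically has a Levy--Khintchine
  representation with a rotation invariant Levy measure.
\<close>

definition levy_khintchine_exponent ::
    "'w measure \<Rightarrow> (real \<Rightarrow> 'w \<Rightarrow> 'a :: euclidean_space) \<Rightarrow> ('a \<Rightarrow> real) \<Rightarrow> bool" where
  "levy_khintchine_exponent M X \<psi> \<longleftrightarrow>
     (\<forall>t\<ge>0. \<forall>\<xi>. (CLINT x|distr M borel (X t). iexp (\<xi> \<bullet> x)) = exp (- complex_of_real (t * \<psi> \<xi>)))"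

text \<open>
  The value taken by a radial function on the sphere of radius \<open>r\<close>; meaningful only if \<open>f\<close> is
  radial and \<open>r \<ge> 0\<close>.
\<close>

definition radial_profile :: "('a :: euclidean_space \<Rightarrow> real) \<Rightarrow> real \<Rightarrow> real" where
  "radial_profile f r = (THE y. \<forall>\<xi>. norm \<xi> = r \<longrightarrow> f \<xi> = y)"

definition regularly_varying_at_top :: "real \<Rightarrow> (real \<Rightarrow> real) \<Rightarrow> bool" where
  "regularly_varying_at_top \<alpha> f \<longleftrightarrow>
     (\<exists>x\<^sub>0>0. \<forall>x\<ge>x\<^sub>0. f x > 0) \<and>
     (\<forall>l>0. ((\<lambda>x. f (l * x) / f x) \<longlongrightarrow> l powr \<alpha>) at_top)"

definition tail_constant :: "nat \<Rightarrow> real \<Rightarrow> real" where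
  "tail_constant d \<alpha> =
     2 powr \<alpha> * Gamma ((real d + \<alpha>) / 2) / (Gamma (real d / 2) * Gamma (1 - \<alpha> / 2))"

end

theory Submission
  imports Defs
begin

text \<open>
  The idea is to compute a Laplace transform. Fix sequences \<open>t n > 0\<close> and \<open>r n\<close> with \<open>r n \<longlonglongrightarrow> \<infinity>\<close> and
  \<open>q n = t n \<psi> (r n) \<longlonglongrightarrow> 0\<close>, and let \<open>Z n\<close> be the square of \<open>r n \<bar>X (t n)\<bar>\<close>. The probability in question is that
  of \<open>Z n \<ge> 1\<close>. Because \<open>exp (- \<bar>x\<bar>\<^sup>2 / 2)\<close> is the characteristic function of a standard Gaussian
  vector \<open>\<xi>\<close>, Fubini's theorem gives, for \<open>c > 0\<close>,

    \<open>E (1 - exp (- c Z n)) = E\<^sub>\<xi> (1 - exp (- t n \<psi> (sqrt (2 c) r n \<bar>\<xi>\<bar>)))\<close>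

  (\<open>laplace_transform_by_gaussian_average\<close>). Divided by \<open>q n\<close>, the integrand on the right tends to
  \<open>(sqrt (2 c) \<bar>\<xi>\<bar>) powr \<alpha>\<close> by regular variation, so that the whole tends to \<open>\<kappa> c powr (\<alpha> / 2)\<close> with
  \<open>\<kappa> = 2 powr (\<alpha> / 2) E\<^sub>\<xi> (\<bar>\<xi>\<bar> powr \<alpha>) = 2 powr \<alpha> Gamma ((d + \<alpha>) / 2) / Gamma (d / 2)\<close>
  (\<open>laplace_transform_limit\<close>, \<open>gaussian_moment\<close>).

  On the other hand \<open>E (1 - exp (- c Z n))\<close> is the integral of \<open>c exp (- c s) P (Z n \<ge> s)\<close> over \<open>s > 0\<close>.
  The monotone functions \<open>P (Z n \<ge> s) / q n\<close> therefore have Laplace transforms that converge to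
  \<open>\<kappa> c powr (\<alpha> / 2 - 1)\<close>, the transform of \<open>\<kappa> s powr (- \<alpha> / 2) / Gamma (1 - \<alpha> / 2)\<close>. Monotonicity gives
  convergence of the functions themselves (\<open>tauberian_tail\<close>), and at \<open>s = 1\<close> the limit is the stated
  constant.

  The passage to the limit under the Gaussian integral needs a bound
  \<open>\<psi> (\<rho> r) \<le> C (1 + \<rho>\<^sup>2) \<psi> (r)\<close> for all \<open>\<rho> \<ge> 0\<close> and all large \<open>r\<close>
  (\<open>regularly_varying_quadratic_bound\<close>). It combines the Baire theorem with two inequalities that every
  exponent satisfies, \<open>\<psi> (\<xi> - \<zeta>) \<le> 2 \<psi> \<xi> + 2 \<psi> \<zeta>\<close> and \<open>\<psi> (k \<xi>) \<le> k\<^sup>2 \<psi> \<xi>\<close>; they are limits, as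
  \<open>t\<close> tends to zero, of the corresponding inequalities for \<open>1 - cos\<close>.
\<close>

section \<open>A Tauberian theorem for tails\<close>

text \<open>
  This is the Laplace transform of a power; it identifies the limit measure in the Tauberian theorem.
\<close>
lemma has_integral_Gamma_scaled:
  fixes x c :: real
  assumes x: "x > 0" and c: "c > 0"
  shows "((\<lambda>s. s powr (x - 1) * exp (- (c * s))) has_integral Gamma x * c powr (- x)) {0..}"
proof -
  let ?f = "\<lambda>s. indicator {0..} s * s powr (x - 1) / exp s"
  have "has_bochner_integral lborel ?f (Gamma x)"
    by (rule has_bochner_integral_nn_integral)
       (use x Gamma_conv_nn_integral_real[OF x] in \<open>auto simp: Gamma_real_pos less_imp_le\<close>)
  then have "has_bochner_integral lborel (\<lambda>s. ?f (0 + c * s)) (Gamma x /\<^sub>R \<bar>c\<bar>)"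
    by (subst (asm) lborel_has_bochner_integral_real_affine_iff[where c = c and t = 0]) (use c in auto)
  then have "((\<lambda>s. ?f (c * s)) has_integral (Gamma x / c)) UNIV"
    using c has_integral_integral_lborel[of "\<lambda>s. ?f (c * s)"]
    by (auto simp: has_bochner_integral_iff divide_inverse mult.commute)
  then have "((\<lambda>s. c powr (1 - x) * ?f (c * s)) has_integral c powr (1 - x) * (Gamma x / c)) UNIV"
    by (rule has_integral_mult_right)
  also have "(\<lambda>s. c powr (1 - x) * ?f (c * s))
      = (\<lambda>s. if s \<in> {0..} then s powr (x - 1) * exp (- (c * s)) else 0)"
  proof
    fix s :: real
    have "c powr (1 - x) * c powr (x - 1) = 1"
      using c by (simp flip: powr_add)
    then show "c powr (1 - x) * ?f (c * s)
        = (if s \<in> {0..} then s powr (x - 1) * exp (- (c * s)) else 0)"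
      using c by (simp add: powr_mult exp_minus field_simps zero_le_mult_iff split: split_indicator)
  qed
  also have "c powr (1 - x) * (Gamma x / c) = Gamma x * c powr (- x)"
    using c by (simp add: powr_diff powr_minus field_simps)
  finally show ?thesis
    by (simp only: has_integral_restrict_UNIV)
qed

text \<open>
  A linear combination of the functions \<open>1 - exp (- m z)\<close>, \<open>m = 1, 2, \<dots>\<close>, lies between the
  indicators of two half-lines, up to a small multiple of \<open>1 - exp (- z)\<close>. The error has to
  vanish at \<open>z = 0\<close>, since the measures to which the lemma is applied have a total mass that tends to
  infinity near the origin. For this reason the derivative of the approximated function is
  approximated: a bump \<open>k\<close> of mass one on \<open>[a, b]\<close> is written as \<open>h (exp (- s)) exp (- s)\<close>, \<open>h\<close> is
  replaced by a polynomial \<open>p\<close> with the Weierstrass theorem, and the result is integrated from \<open>0\<close> to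
  \<open>z\<close>. The integral of \<open>k\<close> lies between the indicators of \<open>[b, \<infinity>)\<close> and \<open>[a, \<infinity>)\<close>.

  The last two inequalities evaluate the combination under the substitution of \<open>m powr \<beta>\<close> for
  \<open>1 - exp (- m z)\<close>, which is what the limiting tail \<open>W s = s powr (- \<beta>) / Gamma (1 - \<beta>)\<close>
  assigns to these functions; the value is compared with the integral of \<open>W\<close> against \<open>k\<close>, which is
  an average of \<open>W\<close> over \<open>[a, b]\<close>.
\<close>
lemma exponential_sum_approximates_indicator:
  fixes a b \<beta> \<eta> :: real
  assumes ab: "0 < a" "a < b" and \<beta>: "0 \<le> \<beta>" "\<beta> < 1" and \<eta>: "\<eta> > 0"
  obtains n c where
    "\<And>z. z \<ge> 0 \<Longrightarrow> of_bool (b \<le> z) - \<eta> * (1 - exp (- z)) \<le> (\<Sum>i\<le>n::nat. c i * (1 - exp (- (real (Suc i) * z))))"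
    "\<And>z. z \<ge> 0 \<Longrightarrow> (\<Sum>i\<le>n. c i * (1 - exp (- (real (Suc i) * z)))) \<le> of_bool (a \<le> z) + \<eta> * (1 - exp (- z))"
    "b powr (- \<beta>) / Gamma (1 - \<beta>) - \<eta> \<le> (\<Sum>i\<le>n. c i * real (Suc i) powr \<beta>)"
    "(\<Sum>i\<le>n. c i * real (Suc i) powr \<beta>) \<le> a powr (- \<beta>) / Gamma (1 - \<beta>) + \<eta>"
proof -
  \<comment> \<open>The constant makes the integral of the bump equal to one.\<close>
  define C where "C = 6 / (b - a) ^ 3"
  define k where "k = (\<lambda>s. C * max 0 ((s - a) * (b - s)))"
  \<comment> \<open>Truncating at \<open>exp (- b)\<close> changes nothing, as \<open>k\<close> vanishes beyond \<open>b\<close>, and makes \<open>h\<close> continuous at \<open>0\<close>.\<close>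
  define m where "m = (\<lambda>y. max y (exp (- b)))"
  define h where "h = (\<lambda>y. k (- ln (m y)) / m y)"
  have C: "C > 0" using ab by (simp add: C_def)
  have k_nonneg: "k s \<ge> 0" for s using C by (simp add: k_def)
  have k_zero: "k s = 0" if "s \<notin> {a..b}" for s
  proof -
    have "(s - a) * (b - s) \<le> 0"
      using that ab by (auto simp: mult_le_0_iff)
    then show ?thesis by (simp add: k_def)
  qed
  have k_cont: "continuous_on S k" for S
    unfolding k_def by (intro continuous_intros)
  have k_int: "(k has_integral 1) {a..b}"
  proof -
    define \<Phi> where "\<Phi> = (\<lambda>s. C * ((a + b) * s ^ 2 / 2 - s ^ 3 / 3 - a * b * s))"
    have "((\<lambda>s. C * ((s - a) * (b - s))) has_integral (\<Phi> b - \<Phi> a)) {a..b}"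
      unfolding \<Phi>_def using ab
      by (intro fundamental_theorem_of_calculus)
         (auto intro!: derivative_eq_intros simp flip: has_real_derivative_iff_has_vector_derivative
               simp: field_simps power2_eq_square)
    also have "\<Phi> b - \<Phi> a = C * ((b - a) ^ 3 / 6)"
      unfolding \<Phi>_def by (simp add: field_simps power2_eq_square power3_eq_cube)
    also have "\<dots> = 1" using ab by (simp add: C_def)
    finally show ?thesis
      by (rule has_integral_eq[rotated]) (auto simp: k_def max_def mult_le_0_iff)
  qed
  have h_exp: "h (exp (- s)) * exp (- s) = k s" if "s \<ge> 0" for s
  proof (cases "s \<le> b")
    case True
    then have "m (exp (- s)) = exp (- s)" by (simp add: m_def)
    then show ?thesis by (simp add: h_def)
  next
    case False
    then have "m (exp (- s)) = exp (- b)" by (simp add: m_def)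
    moreover have "k b = 0" by (simp add: k_def)
    ultimately show ?thesis using k_zero[of s] False by (simp add: h_def)
  qed
  have m_pos: "m y > 0" for y by (simp add: m_def less_max_iff_disj)
  have "continuous_on {0..1} (\<lambda>y. - ln (m y))"
    using less_imp_neq[OF m_pos] unfolding m_def by (intro continuous_intros) metis
  then have "continuous_on {0..1} h"
    unfolding h_def using m_pos
    by (intro continuous_on_divide continuous_on_compose2[OF k_cont[of UNIV]])
       (auto intro!: continuous_intros simp: m_def less_le)
  then obtain p where p: "real_polynomial_function p" "\<And>y. y \<in> {0..1} \<Longrightarrow> \<bar>h y - p y\<bar> < \<eta>"
    using Stone_Weierstrass_real_polynomial_function[of "{0..1}" h \<eta>] \<eta> by auto
  then obtain A n where pA: "p = (\<lambda>y. \<Sum>i\<le>n. A i * y ^ i)"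
    unfolding real_polynomial_function_iff_sum by auto
  define S where "S = (\<lambda>z. \<Sum>i\<le>n. A i / real (Suc i) * (1 - exp (- (real (Suc i) * z))))"
  define V where "V = (\<Sum>i\<le>n. A i / real (Suc i) * real (Suc i) powr \<beta>)"
  define u where "u = (\<lambda>s. p (exp (- s)) * exp (- s))"
  have u_sum: "u s = (\<Sum>i\<le>n. A i * exp (- (real (Suc i) * s)))" for s
    unfolding u_def pA sum_distrib_right
    by (intro sum.cong refl) (simp add: exp_of_nat_mult[symmetric] exp_add[symmetric] algebra_simps)
  have close: "\<bar>k s - u s\<bar> \<le> \<eta> * exp (- s)" if "s \<ge> 0" for s
  proof -
    have "\<bar>h (exp (- s)) - p (exp (- s))\<bar> * exp (- s) \<le> \<eta> * exp (- s)"
      using p(2)[of "exp (- s)"] that by (intro mult_right_mono) auto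
    also have "\<bar>h (exp (- s)) - p (exp (- s))\<bar> * exp (- s) = \<bar>k s - u s\<bar>"
      unfolding u_def h_exp[OF that, symmetric]
      by (metis abs_exp_cancel abs_mult left_diff_distrib)
    finally show ?thesis .
  qed
  have S_bounds: "of_bool (b \<le> z) - \<eta> * (1 - exp (- z)) \<le> S z
      \<and> S z \<le> of_bool (a \<le> z) + \<eta> * (1 - exp (- z))" if z: "z \<ge> 0" for z
  proof -
    have exp_int: "((\<lambda>s. exp (- (c * s))) has_integral (1 - exp (- (c * z))) / c) {0..z}"
      if "c > 0" for c :: real
    proof -
      have "((\<lambda>s. exp (- (c * s))) has_integral (- exp (- (c * z)) / c - - exp (- (c * 0)) / c)) {0..z}"
        using z that by (intro fundamental_theorem_of_calculus)
         (auto intro!: derivative_eq_intros simp flip: has_real_derivative_iff_has_vector_derivative)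
      then show ?thesis by (simp add: diff_divide_distrib)
    qed
    have "(u has_integral (\<Sum>i\<le>n. A i * ((1 - exp (- (real (Suc i) * z))) / real (Suc i)))) {0..z}"
      unfolding u_sum[abs_def] by (intro has_integral_sum has_integral_mult_right exp_int) auto
    then have u_int: "(u has_integral S z) {0..z}" by (simp add: S_def)
    have e_int: "((\<lambda>s. \<eta> * exp (- s)) has_integral (\<eta> * (1 - exp (- z)))) {0..z}"
      using has_integral_mult_right[OF exp_int[of 1], of \<eta>] by simp
    have kI: "(k has_integral integral {0..z} k) {0..z}"
      by (intro integrable_integral integrable_continuous_interval k_cont)
    have "integral {0..z} k \<le> S z + \<eta> * (1 - exp (- z))"
      by (rule has_integral_le[OF kI has_integral_add[OF u_int e_int]]) (use close in force)
    moreover have "S z \<le> integral {0..z} k + \<eta> * (1 - exp (- z))"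
      by (rule has_integral_le[OF u_int has_integral_add[OF kI e_int]]) (use close in force)
    moreover have "integral {0..z} k \<le> of_bool (a \<le> z)"
    proof (cases "a \<le> z")
      case True
      have k_sup: "(k has_integral 1) {min 0 a..max z b}"
        by (rule has_integral_on_superset[OF k_int]) (use k_zero ab in auto)
      have "integral {0..z} k \<le> 1"
        by (rule has_integral_subset_le[OF _ kI k_sup]) (use k_nonneg ab in auto)
      then show ?thesis using True by simp
    next
      case False
      then have "integral {0..z} k = 0"
        by (intro integral_unique has_integral_is_0) (use k_zero in auto)
      then show ?thesis by simp
    qed
    moreover have "of_bool (b \<le> z) \<le> integral {0..z} k"
    proof (cases "b \<le> z")
      case True
      then have "1 \<le> integral {0..z} k"
        by (intro has_integral_subset_le[OF _ k_int kI]) (use k_nonneg ab in auto)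
      then show ?thesis using True by simp
    next
      case False
      then show ?thesis using k_nonneg by (simp add: integral_nonneg kI[THEN has_integral_integrable])
    qed
    ultimately show ?thesis by linarith
  qed
  define W where "W = (\<lambda>s. s powr (- \<beta>) / Gamma (1 - \<beta>))"
  have G: "Gamma (1 - \<beta>) > 0" using \<beta> by (simp add: Gamma_real_pos)
  have W_nonneg: "W s \<ge> 0" for s using G by (simp add: W_def)
  have W_exp: "((\<lambda>s. W s * exp (- (c * s))) has_integral c powr (\<beta> - 1)) {0..}" if "c > 0" for c
  proof -
    have "((\<lambda>s. (1 / Gamma (1 - \<beta>)) * (s powr ((1 - \<beta>) - 1) * exp (- (c * s)))) has_integral
        (1 / Gamma (1 - \<beta>)) * (Gamma (1 - \<beta>) * c powr (- (1 - \<beta>)))) {0..}"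
      by (intro has_integral_mult_right has_integral_Gamma_scaled) (use \<beta> that in auto)
    then show ?thesis using G by (simp add: W_def)
  qed
  have Wu: "((\<lambda>s. W s * u s) has_integral V) {0..}"
  proof -
    have "((\<lambda>s. \<Sum>i\<le>n. A i * (W s * exp (- (real (Suc i) * s)))) has_integral
        (\<Sum>i\<le>n. A i * real (Suc i) powr (\<beta> - 1))) {0..}"
      by (intro has_integral_sum has_integral_mult_right W_exp) auto
    then show ?thesis
      by (simp add: u_sum V_def sum_distrib_left powr_diff mult_ac)
  qed
  have We: "((\<lambda>s. W s * (\<eta> * exp (- s))) has_integral \<eta>) {0..}"
    using has_integral_mult_right[OF W_exp[of 1], of \<eta>] by (simp add: mult_ac)
  have "(\<lambda>s. W s * k s) integrable_on {a..b}"
    using ab by (intro integrable_continuous_interval continuous_intros k_cont)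
      (use ab G in \<open>auto simp: W_def intro!: continuous_intros\<close>)
  then obtain J where J: "((\<lambda>s. W s * k s) has_integral J) {a..b}" by blast
  have J0: "((\<lambda>s. W s * k s) has_integral J) {0..}"
    by (rule has_integral_on_superset[OF J]) (use k_zero ab in auto)
  have Wab: "W b \<le> W s \<and> W s \<le> W a" if "s \<in> {a..b}" for s
    using that ab \<beta> G unfolding W_def by (auto intro!: divide_right_mono powr_mono2')
  have "W b * 1 \<le> J"
    by (rule has_integral_le[OF has_integral_mult_right[OF k_int] J])
       (use Wab k_nonneg in \<open>auto intro!: mult_right_mono\<close>)
  moreover have "J \<le> W a * 1"
    by (rule has_integral_le[OF J has_integral_mult_right[OF k_int]])
       (use Wab k_nonneg in \<open>auto intro!: mult_right_mono\<close>)
  moreover have "J \<le> V + \<eta>"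
  proof (rule has_integral_le[OF J0 has_integral_add[OF Wu We]])
    fix s :: real assume "s \<in> {0..}"
    then have "k s \<le> u s + \<eta> * exp (- s)" using close[of s] by auto
    from mult_left_mono[OF this W_nonneg[of s]]
    show "W s * k s \<le> W s * u s + W s * (\<eta> * exp (- s))" by (simp add: distrib_left)
  qed
  moreover have "V \<le> J + \<eta>"
  proof (rule has_integral_le[OF Wu has_integral_add[OF J0 We]])
    fix s :: real assume "s \<in> {0..}"
    then have "u s \<le> k s + \<eta> * exp (- s)" using close[of s] by auto
    from mult_left_mono[OF this W_nonneg[of s]]
    show "W s * u s \<le> W s * k s + W s * (\<eta> * exp (- s))" by (simp add: distrib_left)
  qed
  ultimately have "W b - \<eta> \<le> V" "V \<le> W a + \<eta>" by auto
  then show ?thesis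
    using that[where n = n and c = "\<lambda>i. A i / real (Suc i)"] S_bounds unfolding S_def V_def W_def by blast
qed

text \<open>
  This is Karamata's Tauberian theorem in the form of a continuity theorem for tails. If the measures
  \<open>\<mu> n / q n\<close> assign to \<open>1 - exp (- m Z)\<close> asymptotically the value \<open>\<kappa> m powr \<beta>\<close> for all integers
  \<open>m > 0\<close>, then their tails converge to the function with this Laplace transform, at the point \<open>1\<close>.
  Integers \<open>m\<close> determine the limit, because they provide all polynomials in \<open>exp (- z)\<close>.

  The preceding lemma gives upper and lower bounds for the tail at \<open>b\<close> and at \<open>a\<close> by the limiting tail
  \<open>W\<close> at \<open>a\<close> and at \<open>b\<close>. As \<open>W\<close> is continuous at \<open>1\<close>, letting \<open>a\<close> increase to \<open>b = 1\<close>,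
  and \<open>b\<close> decrease to \<open>a = 1\<close>, gives the claim.
\<close>
theorem tauberian_tail:
  fixes \<mu> :: "nat \<Rightarrow> 'a measure" and Z :: "nat \<Rightarrow> 'a \<Rightarrow> real" and q :: "nat \<Rightarrow> real"
  assumes \<mu>: "\<And>n. prob_space (\<mu> n)"
    and Z [measurable]: "\<And>n. Z n \<in> borel_measurable (\<mu> n)" and Z_nonneg: "\<And>n x. Z n x \<ge> 0"
    and q: "\<And>n. q n > 0" and \<beta>: "0 \<le> \<beta>" "\<beta> < 1"
    and lim: "\<And>i. (\<lambda>n. (\<integral>x. 1 - exp (- (real (Suc i) * Z n x)) \<partial>\<mu> n) / q n)
                 \<longlonglongrightarrow> \<kappa> * real (Suc i) powr \<beta>"
  shows "(\<lambda>n. measure (\<mu> n) {x \<in> space (\<mu> n). Z n x \<ge> 1} / q n) \<longlonglongrightarrow> \<kappa> / Gamma (1 - \<beta>)"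
proof -
  have G: "Gamma (1 - \<beta>) > 0" using \<beta> by (simp add: Gamma_real_pos)
  define W where "W s = s powr (- \<beta>) / Gamma (1 - \<beta>)" for s
  define L where "L = (\<lambda>n f. (\<integral>x. f (Z n x) \<partial>\<mu> n) / q n)"
  have int: "integrable (\<mu> n) (\<lambda>x. 1 - exp (- (real (Suc i) * Z n x)))" for n i
  proof -
    interpret prob_space "\<mu> n" by fact
    show ?thesis
      by (rule integrable_const_bound[where B = 1]) (use Z_nonneg in auto)
  qed
  have int1: "integrable (\<mu> n) (\<lambda>x. 1 - exp (- Z n x))" for n
    using int[of n 0] by simp
  have int2: "integrable (\<mu> n) (\<lambda>x. of_bool (c \<le> Z n x) :: real)" for n c
  proof -
    interpret prob_space "\<mu> n" by fact
    show ?thesis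
      by (rule integrable_const_bound[where B = 1]) auto
  qed
  have prob: "measure (\<mu> n) {x \<in> space (\<mu> n). Z n x \<ge> c} / q n = L n (\<lambda>z. of_bool (c \<le> z))" for n c
  proof -
    have "(\<integral>x. of_bool (c \<le> Z n x) \<partial>\<mu> n) = (\<integral>x. indicator {x \<in> space (\<mu> n). Z n x \<ge> c} x \<partial>\<mu> n :: real)"
      by (intro Bochner_Integration.integral_cong) (auto split: split_indicator)
    also have "\<dots> = measure (\<mu> n) {x \<in> space (\<mu> n). Z n x \<ge> c}"
      by (simp add: Collect_conj_eq Int_absorb2 sets.sets_into_space)
    finally show ?thesis by (simp add: L_def)
  qed
  have lim1: "(\<lambda>n. L n (\<lambda>z. 1 - exp (- z))) \<longlonglongrightarrow> \<kappa>"
    using lim[of 0] by (simp add: L_def)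
  have "0 \<le> L n (\<lambda>z. 1 - exp (- z))" for n
    unfolding L_def using q[of n] Z_nonneg by (intro divide_nonneg_pos Bochner_Integration.integral_nonneg) auto
  then have \<kappa>: "\<kappa> \<ge> 0" by (intro LIMSEQ_le_const[OF lim1]) auto
  have limS: "(\<lambda>n. L n (\<lambda>z. \<Sum>i\<le>N. c i * (1 - exp (- (real (Suc i) * z)))))
      \<longlonglongrightarrow> \<kappa> * (\<Sum>i\<le>N. c i * real (Suc i) powr \<beta>)" for N :: nat and c :: "nat \<Rightarrow> real"
  proof -
    have "L n (\<lambda>z. \<Sum>i\<le>N. c i * (1 - exp (- (real (Suc i) * z))))
        = (\<Sum>i\<le>N. c i * L n (\<lambda>z. 1 - exp (- (real (Suc i) * z))))" for n
      unfolding L_def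
      by (subst Bochner_Integration.integral_sum)
         (auto intro!: integrable_mult_right int simp: sum_divide_distrib simp del: of_nat_Suc)
    moreover have "(\<lambda>n. \<Sum>i\<le>N. c i * L n (\<lambda>z. 1 - exp (- (real (Suc i) * z))))
        \<longlonglongrightarrow> (\<Sum>i\<le>N. c i * (\<kappa> * real (Suc i) powr \<beta>))"
      unfolding L_def by (intro tendsto_sum tendsto_mult tendsto_const lim)
    ultimately show ?thesis by (simp add: sum_distrib_left mult_ac)
  qed
  have intS: "integrable (\<mu> n) (\<lambda>x. \<Sum>i\<le>N. c i * (1 - exp (- (real (Suc i) * Z n x))))"
    for n N and c :: "nat \<Rightarrow> real"
    by (intro Bochner_Integration.integrable_sum integrable_mult_right int)
  have upper: "eventually (\<lambda>n. L n (\<lambda>z. of_bool (b \<le> z)) < \<kappa> * W a + \<epsilon>) sequentially"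
    and lower: "eventually (\<lambda>n. \<kappa> * W b - \<epsilon> < L n (\<lambda>z. of_bool (a \<le> z))) sequentially"
    if ab: "0 < a" "a < b" and \<epsilon>: "\<epsilon> > 0" for a b \<epsilon>
  proof -
    \<comment> \<open>The error \<open>\<eta>\<close> enters twice with the factor \<open>\<kappa>\<close>: through the pointwise bounds and through the value of the sum.\<close>
    define \<eta> where "\<eta> = \<epsilon> / (2 * \<kappa> + 1)"
    have \<eta>: "\<eta> > 0" using \<epsilon> \<kappa> by (simp add: \<eta>_def)
    have "(2 * \<kappa> + 1) * \<eta> = \<epsilon>" using \<kappa> by (simp add: \<eta>_def)
    then have \<eta>': "2 * \<kappa> * \<eta> < \<epsilon>" using \<eta> by (simp add: algebra_simps)
    obtain N c where S:
      "\<And>z. z \<ge> 0 \<Longrightarrow> of_bool (b \<le> z) - \<eta> * (1 - exp (- z)) \<le> (\<Sum>i\<le>N::nat. c i * (1 - exp (- (real (Suc i) * z))))"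
      "\<And>z. z \<ge> 0 \<Longrightarrow> (\<Sum>i\<le>N. c i * (1 - exp (- (real (Suc i) * z)))) \<le> of_bool (a \<le> z) + \<eta> * (1 - exp (- z))"
      "W b - \<eta> \<le> (\<Sum>i\<le>N. c i * real (Suc i) powr \<beta>)"
      "(\<Sum>i\<le>N. c i * real (Suc i) powr \<beta>) \<le> W a + \<eta>"
      by (rule exponential_sum_approximates_indicator[OF ab \<beta> \<eta>, folded W_def]) (rule that)
    define S where "S = (\<lambda>z. \<Sum>i\<le>N. c i * (1 - exp (- (real (Suc i) * z))))"
    define V where "V = (\<Sum>i\<le>N. c i * real (Suc i) powr \<beta>)"
    have limS': "(\<lambda>n. L n S) \<longlonglongrightarrow> \<kappa> * V"
      unfolding S_def V_def by (rule limS)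
    have intS': "integrable (\<mu> n) (\<lambda>x. S (Z n x))" for n
      unfolding S_def by (rule intS)
    have int_e: "integrable (\<mu> n) (\<lambda>x. \<eta> * (1 - exp (- Z n x)))" for n
      by (intro integrable_mult_right int1)
    have up: "L n (\<lambda>z. of_bool (b \<le> z)) \<le> L n S + \<eta> * L n (\<lambda>z. 1 - exp (- z))" for n
    proof -
      have "(\<integral>x. of_bool (b \<le> Z n x) \<partial>\<mu> n) \<le> (\<integral>x. S (Z n x) + \<eta> * (1 - exp (- Z n x)) \<partial>\<mu> n)"
      proof (intro integral_mono int2 Bochner_Integration.integrable_add intS' int_e)
        fix x show "of_bool (b \<le> Z n x) \<le> S (Z n x) + \<eta> * (1 - exp (- Z n x))"
          using S(1)[OF Z_nonneg[of n x]] unfolding S_def by linarith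
      qed
      also have "\<dots> = (\<integral>x. S (Z n x) \<partial>\<mu> n) + \<eta> * (\<integral>x. 1 - exp (- Z n x) \<partial>\<mu> n)"
        by (simp only: Bochner_Integration.integral_add[OF intS' int_e] integral_mult_right_zero)
      finally show ?thesis using q[of n] by (simp add: L_def field_simps)
    qed
    have low: "L n S - \<eta> * L n (\<lambda>z. 1 - exp (- z)) \<le> L n (\<lambda>z. of_bool (a \<le> z))" for n
    proof -
      have "(\<integral>x. S (Z n x) - \<eta> * (1 - exp (- Z n x)) \<partial>\<mu> n) \<le> (\<integral>x. of_bool (a \<le> Z n x) \<partial>\<mu> n)"
      proof (rule integral_mono[OF Bochner_Integration.integrable_diff[OF intS' int_e] int2])
        fix x show "S (Z n x) - \<eta> * (1 - exp (- Z n x)) \<le> of_bool (a \<le> Z n x)"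
          using S(2)[OF Z_nonneg[of n x]] unfolding S_def by linarith
      qed
      moreover have "(\<integral>x. S (Z n x) - \<eta> * (1 - exp (- Z n x)) \<partial>\<mu> n)
          = (\<integral>x. S (Z n x) \<partial>\<mu> n) - \<eta> * (\<integral>x. 1 - exp (- Z n x) \<partial>\<mu> n)"
        by (simp only: Bochner_Integration.integral_diff[OF intS' int_e] integral_mult_right_zero)
      ultimately have "((\<integral>x. S (Z n x) \<partial>\<mu> n) - \<eta> * (\<integral>x. 1 - exp (- Z n x) \<partial>\<mu> n)) / q n
          \<le> (\<integral>x. of_bool (a \<le> Z n x) \<partial>\<mu> n) / q n"
        using q[of n] by (intro divide_right_mono) auto
      then show ?thesis by (simp add: L_def diff_divide_distrib)
    qed
    have "(\<lambda>n. L n S + \<eta> * L n (\<lambda>z. 1 - exp (- z))) \<longlonglongrightarrow> \<kappa> * V + \<eta> * \<kappa>"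
      by (intro tendsto_intros limS' lim1)
    moreover have "\<kappa> * V + \<eta> * \<kappa> < \<kappa> * W a + \<epsilon>"
      using mult_left_mono[OF S(4)[folded V_def] \<kappa>] \<eta>' by (simp add: algebra_simps)
    ultimately have "eventually (\<lambda>n. L n S + \<eta> * L n (\<lambda>z. 1 - exp (- z)) < \<kappa> * W a + \<epsilon>) sequentially"
      by (rule order_tendstoD)
    then show "eventually (\<lambda>n. L n (\<lambda>z. of_bool (b \<le> z)) < \<kappa> * W a + \<epsilon>) sequentially"
      by eventually_elim (use up in \<open>auto intro: le_less_trans\<close>)
    have "(\<lambda>n. L n S - \<eta> * L n (\<lambda>z. 1 - exp (- z))) \<longlonglongrightarrow> \<kappa> * V - \<eta> * \<kappa>"
      by (intro tendsto_intros limS' lim1)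
    moreover have "\<kappa> * W b - \<epsilon> < \<kappa> * V - \<eta> * \<kappa>"
      using mult_left_mono[OF S(3)[folded V_def] \<kappa>] \<eta>' by (simp add: algebra_simps)
    ultimately have "eventually (\<lambda>n. \<kappa> * W b - \<epsilon> < L n S - \<eta> * L n (\<lambda>z. 1 - exp (- z))) sequentially"
      by (rule order_tendstoD)
    then show "eventually (\<lambda>n. \<kappa> * W b - \<epsilon> < L n (\<lambda>z. of_bool (a \<le> z))) sequentially"
      by eventually_elim (use low in \<open>auto intro: less_le_trans\<close>)
  qed
  have "isCont W 1"
    unfolding W_def[abs_def] using G by (intro continuous_intros) auto
  then have W_tendsto: "(W \<longlongrightarrow> W 1) (at_left 1)" "(W \<longlongrightarrow> W 1) (at_right 1)"
    by (auto simp: isCont_def intro: tendsto_mono at_le)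
  have W1: "\<kappa> / Gamma (1 - \<beta>) = \<kappa> * W 1" by (simp add: W_def)
  show ?thesis
    unfolding prob W1
  proof (rule order_tendstoI)
    fix y assume y: "\<kappa> * W 1 < y"
    have "((\<lambda>a. \<kappa> * W a) \<longlongrightarrow> \<kappa> * W 1) (at_left 1)"
      by (intro tendsto_intros W_tendsto)
    from order_tendstoD(2)[OF this y]
    have "eventually (\<lambda>a. \<kappa> * W a < y \<and> a \<in> {0<..<1}) (at_left 1)"
      by (intro eventually_conj eventually_at_left_real) auto
    then obtain a where a: "\<kappa> * W a < y" "0 < a" "a < 1"
      using eventually_happens'[OF trivial_limit_at_left_real] by fastforce
    show "eventually (\<lambda>n. L n (\<lambda>z. of_bool (1 \<le> z)) < y) sequentially"
      using upper[of a 1 "y - \<kappa> * W a"] a by simp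
  next
    fix y assume y: "y < \<kappa> * W 1"
    have "((\<lambda>b. \<kappa> * W b) \<longlongrightarrow> \<kappa> * W 1) (at_right 1)"
      by (intro tendsto_intros W_tendsto)
    from order_tendstoD(1)[OF this y]
    have "eventually (\<lambda>b. y < \<kappa> * W b \<and> b \<in> {1<..<2}) (at_right 1)"
      by (intro eventually_conj eventually_at_right_real) auto
    then obtain b where b: "y < \<kappa> * W b" "1 < b"
      using eventually_happens'[OF trivial_limit_at_right_real] by fastforce
    show "eventually (\<lambda>n. y < L n (\<lambda>z. of_bool (1 \<le> z))) sequentially"
      using lower[of 1 b "\<kappa> * W b - y"] b by simp
  qed
qed

section \<open>A quadratic bound from regular variation\<close>

text \<open>
  If no member of the cover contained an interval, all complements would be open and dense, and their
  intersection would be dense by the Baire theorem; but it is empty.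
\<close>
lemma closed_cover_contains_interval:
  fixes F :: "nat \<Rightarrow> real set"
  assumes closed: "\<And>n. closed (F n)" and cover: "{1..2} \<subseteq> (\<Union>n. F n)"
  obtains n a b where "1 \<le> a" "a < b" "b \<le> 2" "{a..b} \<subseteq> F n"
proof (rule ccontr)
  note found = that
  assume no: "\<not> thesis"
  let ?S = "{1..2::real}"
  have "?S \<subseteq> closure (\<Inter>n. ?S - F n)"
  proof (rule Baire)
    fix T assume "T \<in> range (\<lambda>n. ?S - F n)"
    then obtain n where T: "T = ?S - F n" by auto
    have "openin (top_of_set ?S) T"
      unfolding T using closed[of n] by (metis Diff_eq closed_def openin_open_Int)
    moreover have "x \<in> closure T" if x: "x \<in> ?S" for x
    proof (subst closure_approachable, intro allI impI)
      fix e :: real assume e: "e > 0"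
      define a where "a = max 1 (x - e / 2)"
      define b where "b = min 2 (x + e / 2)"
      have ab: "1 \<le> a" "a < b" "b \<le> 2" using x e by (auto simp: a_def b_def)
      then have "\<not> {a..b} \<subseteq> F n" using no found by blast
      then obtain y where "y \<in> {a..b}" "y \<notin> F n" by blast
      then show "\<exists>y\<in>T. dist y x < e"
        using ab e by (intro bexI[of _ y]) (auto simp: T a_def b_def dist_real_def)
    qed
    ultimately show "openin (top_of_set ?S) T \<and> ?S \<subseteq> closure T" by blast
  qed auto
  moreover have "(\<Inter>n. ?S - F n) = {}" using cover by auto
  ultimately have "?S \<subseteq> {}" by (simp only: closure_empty)
  then show False by simp
qed

text \<open>
  This replaces Potter's bounds. By Baire, the convergence that defines regular variation is
  uniformly bounded for factors in some interval \<open>[a, b]\<close>. Small factors are differences of two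
  elements of \<open>[a, b]\<close>, and every factor is a multiple of a small one, so the two functional
  inequalities spread the bound to all factors. In this way the bound also covers arguments
  \<open>\<rho> * r\<close> that stay bounded, about which regular variation at infinity says nothing.
\<close>
lemma regularly_varying_quadratic_bound:
  fixes f :: "real \<Rightarrow> real"
  assumes cont: "continuous_on UNIV f"
    and pos: "\<And>x. x \<ge> x0 \<Longrightarrow> f x > 0"
    and rv: "\<And>l. l > 0 \<Longrightarrow> ((\<lambda>x. f (l * x) / f x) \<longlongrightarrow> l powr \<alpha>) at_top"
    and diff: "\<And>x y. f (x - y) \<le> 2 * f x + 2 * f y"
    and mult: "\<And>(k::nat) x. f (real k * x) \<le> (real k)\<^sup>2 * f x"
  obtains C R where "C > 0" "\<And>r \<rho>. r \<ge> R \<Longrightarrow> \<rho> \<ge> 0 \<Longrightarrow> f (\<rho> * r) \<le> C * (1 + \<rho>\<^sup>2) * f r"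
proof -
  define B where "B = 2 powr \<bar>\<alpha>\<bar> + 1"
  have B: "B > 0" by (simp add: B_def add_pos_pos)
  define F where "F = (\<lambda>n::nat. \<Inter>x\<in>{max x0 (real n)..}. {l. f (l * x) \<le> B * f x})"
  obtain n a b where ab: "1 \<le> a" "a < b" "b \<le> 2" and F: "{a..b} \<subseteq> F n"
  proof (rule closed_cover_contains_interval[of F])
    show "closed (F n)" for n
      unfolding F_def
      by (intro closed_INT ballI closed_Collect_le continuous_on_compose2[OF cont] continuous_intros) auto
    show "{1..2} \<subseteq> (\<Union>n. F n)"
    proof
      fix l :: real assume l: "l \<in> {1..2}"
      have "l powr \<alpha> \<le> l powr \<bar>\<alpha>\<bar>" using l by (intro powr_mono) auto
      also have "\<dots> \<le> 2 powr \<bar>\<alpha>\<bar>" using l by (intro powr_mono2) auto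
      finally have "l powr \<alpha> < B" by (simp add: B_def)
      with order_tendstoD(2)[OF rv[of l]] l
      have "eventually (\<lambda>x. f (l * x) / f x < B) at_top" by auto
      then obtain X where X: "\<And>x. x \<ge> X \<Longrightarrow> f (l * x) / f x < B"
        by (auto simp: eventually_at_top_linorder)
      obtain n where n: "real n \<ge> X" using real_arch_simple by blast
      have "f (l * x) \<le> B * f x" if "x \<ge> max x0 (real n)" for x
        using X[of x] pos[of x] n that by (simp add: field_simps)
      then have "l \<in> F n" by (simp add: F_def)
      then show "l \<in> (\<Union>n. F n)" by blast
    qed
  qed
  define R where "R = max x0 (real n)"
  have R: "f (l * r) \<le> B * f r" if "l \<in> {a..b}" "r \<ge> R" for l r
    using F that unfolding F_def R_def by blast
  define w where "w = b - a"
  have w: "w > 0" using ab by (simp add: w_def)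
  have small: "f (l * r) \<le> 4 * B * f r" if "0 \<le> l" "l \<le> w" "r \<ge> R" for l r
  proof -
    have "f (l * r) = f ((a + l) * r - a * r)" by (simp add: algebra_simps)
    also have "\<dots> \<le> 2 * f ((a + l) * r) + 2 * f (a * r)" by (rule diff)
    also have "\<dots> \<le> 2 * (B * f r) + 2 * (B * f r)"
      using R[of "a + l" r] R[of a r] that ab by (intro add_mono mult_left_mono) (auto simp: w_def)
    finally show ?thesis by simp
  qed
  define C where "C = 8 * B * (1 + 1 / w\<^sup>2)"
  show thesis
  proof (rule that[of C R])
    show "C > 0" using B w by (simp add: C_def add_pos_pos)
    fix r \<rho> :: real assume r: "r \<ge> R" and \<rho>: "\<rho> \<ge> 0"
    have fr: "f r > 0" using pos[of r] r by (simp add: R_def)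
    \<comment> \<open>The number \<open>\<rho> / k\<close> is a factor in \<open>[0, w]\<close>; adding one keeps \<open>k\<close> positive.\<close>
    define k where "k = nat \<lfloor>\<rho> / w\<rfloor> + 1"
    have k: "real k > 0" "\<rho> / w \<le> real k" "real k \<le> 1 + \<rho> / w"
      unfolding k_def using divide_nonneg_pos[OF \<rho> w] by linarith+
    have "f (\<rho> * r) = f (real k * (\<rho> / real k * r))" using k by simp
    also have "\<dots> \<le> (real k)\<^sup>2 * f (\<rho> / real k * r)" by (rule mult)
    also have "\<dots> \<le> (real k)\<^sup>2 * (4 * B * f r)"
      using k \<rho> r w by (intro mult_left_mono small) (auto simp: field_simps)
    also have "\<dots> \<le> (2 * (1 + 1 / w\<^sup>2) * (1 + \<rho>\<^sup>2)) * (4 * B * f r)"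
    proof (rule mult_right_mono)
      have "(real k)\<^sup>2 \<le> (1 + \<rho> / w)\<^sup>2" using k by (intro power_mono) auto
      also have "\<dots> \<le> 2 * (1 + \<rho>\<^sup>2 * (1 / w\<^sup>2))"
        using zero_le_power2[of "1 - \<rho> / w"]
        by (simp add: power2_sum power2_diff power_divide)
      also have "\<dots> \<le> 2 * ((1 + 1 / w\<^sup>2) * (1 + \<rho>\<^sup>2))"
      proof -
        define v where "v = 1 / w\<^sup>2"
        have "v \<ge> 0" by (simp add: v_def)
        then show ?thesis unfolding v_def[symmetric] by (simp add: algebra_simps)
      qed
      finally show "(real k)\<^sup>2 \<le> 2 * (1 + 1 / w\<^sup>2) * (1 + \<rho>\<^sup>2)"
        by (simp only: mult.assoc)
    qed (use B fr in auto)
    finally show "f (\<rho> * r) \<le> C * (1 + \<rho>\<^sup>2) * f r" by (simp add: C_def mult_ac)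
  qed
qed

section \<open>The standard Gaussian measure\<close>

definition gaussian :: "'a :: euclidean_space measure" where
  "gaussian = density lborel (\<lambda>x. ennreal (\<Prod>b\<in>Basis. std_normal_density (x \<bullet> b)))"

lemma sets_gaussian [simp, measurable_cong]: "sets gaussian = sets borel"
  by (simp add: gaussian_def)

lemma space_gaussian [simp]: "space gaussian = UNIV"
  by (simp add: gaussian_def)

lemma measurable_gaussian_density [measurable]:
  "(\<lambda>x :: 'a :: euclidean_space. \<Prod>b\<in>Basis. std_normal_density (x \<bullet> b)) \<in> borel_measurable borel"
  by measurable

lemma prob_space_gaussian: "prob_space (gaussian :: 'a :: euclidean_space measure)"
proof
  have "emeasure gaussian (space (gaussian :: 'a measure))
      = (\<integral>\<^sup>+x. (\<Prod>b\<in>Basis. ennreal (std_normal_density (x \<bullet> b))) \<partial>(lborel :: 'a measure))"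
    by (simp add: gaussian_def emeasure_density prod_ennreal)
  also have "\<dots> = (\<Prod>b\<in>(Basis :: 'a set). \<integral>\<^sup>+x. ennreal (std_normal_density x) \<partial>lborel)"
    by (rule nn_integral_lborel_prod) auto
  also have "(\<integral>\<^sup>+x. ennreal (std_normal_density x) \<partial>lborel) = 1"
    using prob_space.emeasure_space_1[OF prob_space_normal_density[of 1 0]]
    by (simp add: emeasure_density)
  finally show "emeasure gaussian (space (gaussian :: 'a measure)) = 1" by simp
qed

text \<open>
  The measure is a product over the coordinates, so the one-dimensional characteristic functions
  multiply.
\<close>
lemma gaussian_characteristic_function:
  fixes \<xi> :: "'a :: euclidean_space"
  shows "(CLINT x|gaussian. iexp (\<xi> \<bullet> x)) = complex_of_real (exp (- (norm \<xi>)\<^sup>2 / 2))"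
proof -
  interpret product_sigma_finite "\<lambda>_ :: 'a. lborel :: real measure" ..
  let ?g = "\<lambda>b y. std_normal_density y *\<^sub>R iexp ((\<xi> \<bullet> b) * y)"
  have std: "prob_space std_normal_distribution"
    by (rule prob_space_normal_density) simp
  have g_integrable: "integrable lborel (?g b)" for b
  proof -
    have "integrable std_normal_distribution (\<lambda>y. iexp ((\<xi> \<bullet> b) * y))"
      by (rule prob_space.integrable_iexp[OF std, of "\<lambda>y. complex_of_real ((\<xi> \<bullet> b) * y)"]) auto
    then show ?thesis by (subst (asm) integrable_density) auto
  qed
  have g_integral: "(\<integral>y. ?g b y \<partial>lborel) = complex_of_real (exp (- (\<xi> \<bullet> b)\<^sup>2 / 2))" for b
    using fun_cong[OF char_std_normal_distribution, of "\<xi> \<bullet> b"]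
    unfolding char_def by (subst (asm) integral_density) auto
  have "(CLINT x|gaussian. iexp (\<xi> \<bullet> x))
      = (CLINT x|lborel. (\<Prod>b\<in>Basis. std_normal_density (x \<bullet> b)) *\<^sub>R iexp (\<xi> \<bullet> x))"
    unfolding gaussian_def by (subst integral_density) (auto intro!: prod_nonneg)
  also have "\<dots> = (CLINT x|lborel. (\<Prod>b\<in>Basis. ?g b (x \<bullet> b)))"
  proof (rule Bochner_Integration.integral_cong[OF refl])
    fix x :: 'a
    have "iexp (\<xi> \<bullet> x) = exp (\<Sum>b\<in>Basis. \<i> * complex_of_real ((\<xi> \<bullet> b) * (x \<bullet> b)))"
      by (subst euclidean_inner) (simp add: sum_distrib_left)
    also have "\<dots> = (\<Prod>b\<in>Basis. iexp ((\<xi> \<bullet> b) * (x \<bullet> b)))"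
      by (rule exp_sum) simp
    finally show "(\<Prod>b\<in>Basis. std_normal_density (x \<bullet> b)) *\<^sub>R iexp (\<xi> \<bullet> x) = (\<Prod>b\<in>Basis. ?g b (x \<bullet> b))"
      by (simp only: scaleR_conv_of_real prod.distrib of_real_prod)
  qed
  also have "\<dots> = (CLINT f|(\<Pi>\<^sub>M b\<in>Basis. lborel). (\<Prod>b\<in>Basis. ?g b (f b)))"
    by (subst lborel_eq, subst integral_distr) (auto intro!: Bochner_Integration.integral_cong)
  also have "\<dots> = (\<Prod>b\<in>Basis. \<integral>y. ?g b y \<partial>lborel)"
    by (rule product_integral_prod) (use g_integrable in auto)
  also have "\<dots> = complex_of_real (exp (\<Sum>b\<in>Basis. - (\<xi> \<bullet> b)\<^sup>2 / 2))"
    by (simp only: g_integral exp_sum[OF finite_Basis] of_real_prod)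
  also have "(\<Sum>b\<in>Basis. - (\<xi> \<bullet> b)\<^sup>2 / 2) = - (norm \<xi>)\<^sup>2 / 2"
    unfolding power2_norm_eq_inner
    by (subst euclidean_inner) (simp add: sum_negf sum_divide_distrib power2_eq_square)
  finally show ?thesis .
qed

lemma gaussian_density_eq:
  fixes x :: "'a :: euclidean_space"
  shows "(\<Prod>b\<in>Basis. std_normal_density (x \<bullet> b)) = (1 / sqrt (2 * pi)) ^ DIM('a) * exp (- (norm x)\<^sup>2 / 2)"
proof -
  have "(\<Prod>b\<in>Basis. std_normal_density (x \<bullet> b))
      = (1 / sqrt (2 * pi)) ^ DIM('a) * exp (\<Sum>b\<in>Basis. - (x \<bullet> b)\<^sup>2 / 2)"
    unfolding std_normal_density_def prod.distrib by (simp add: exp_sum)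
  also have "(\<Sum>b\<in>Basis. - (x \<bullet> b)\<^sup>2 / 2) = - (norm x)\<^sup>2 / 2"
    unfolding power2_norm_eq_inner
    by (subst euclidean_inner) (simp add: sum_negf sum_divide_distrib power2_eq_square)
  finally show ?thesis .
qed

text \<open>
  Polar coordinates. The variable \<open>v = (norm x)\<^sup>2 / 2\<close> is used in place of the radius because the
  Gaussian weight becomes \<open>exp (- v)\<close>, so that moments turn into Gamma integrals without a further
  substitution. Both sides agree on half-lines by the volume of the ball.
\<close>
lemma distr_lborel_half_norm_square:
  defines "D \<equiv> real DIM('a :: euclidean_space) / 2"
  defines "K \<equiv> unit_ball_vol (real DIM('a)) * 2 powr D * D"
  shows "distr (lborel :: 'a measure) borel (\<lambda>x. (norm x)\<^sup>2 / 2)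
    = density lborel (\<lambda>v. ennreal (K * (indicator {0..} v * v powr (D - 1))))" (is "?L = ?R")
proof -
  have D: "D > 0" by (simp add: D_def)
  have K: "K \<ge> 0" using D by (simp add: K_def)
  have R_eq: "emeasure ?R {..v}
      = (\<integral>\<^sup>+s. ennreal (K * (indicator {0..} s * s powr (D - 1))) * indicator {..v} s \<partial>lborel)" for v :: real
    by (rule emeasure_density) auto
  have eq: "emeasure ?L {..v} = emeasure ?R {..v} \<and> emeasure ?L {..v} \<noteq> \<infinity>" for v :: real
  proof (cases "v \<ge> 0")
    case False
    have "emeasure ?L {..v} = emeasure lborel {x :: 'a. (norm x)\<^sup>2 / 2 \<le> v}"
      by (subst emeasure_distr) (auto simp: vimage_def)
    also have "{x :: 'a. (norm x)\<^sup>2 / 2 \<le> v} = {}"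
      using False by (auto simp: not_le intro!: less_le_trans[OF _ zero_le_power2])
    finally have L: "emeasure ?L {..v} = 0" by simp
    have "emeasure ?R {..v} = (\<integral>\<^sup>+(s::real). 0 \<partial>lborel)"
      unfolding R_eq by (intro nn_integral_cong) (use False in \<open>auto simp: indicator_def\<close>)
    with L show ?thesis by simp
  next
    case True
    have "emeasure ?L {..v} = emeasure lborel {x :: 'a. (norm x)\<^sup>2 / 2 \<le> v}"
      by (subst emeasure_distr) (auto simp: vimage_def)
    also have "{x :: 'a. (norm x)\<^sup>2 / 2 \<le> v} = cball 0 (sqrt (2 * v))"
    proof -
      have "(norm x)\<^sup>2 / 2 \<le> v \<longleftrightarrow> norm x \<le> sqrt (2 * v)" for x :: 'a
      proof -
        have "(norm x)\<^sup>2 / 2 \<le> v \<longleftrightarrow> (norm x)\<^sup>2 \<le> 2 * v" by linarith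
        also have "\<dots> \<longleftrightarrow> norm x \<le> sqrt (2 * v)"
          using real_sqrt_le_iff[of "(norm x)\<^sup>2" "2 * v"] unfolding real_sqrt_abs abs_norm_cancel by (rule sym)
        finally show ?thesis .
      qed
      then show ?thesis by (simp add: set_eq_iff)
    qed
    also have "emeasure lborel \<dots> = ennreal (unit_ball_vol (real DIM('a)) * sqrt (2 * v) ^ DIM('a))"
      using True by (intro emeasure_cball) auto
    also have "sqrt (2 * v) ^ DIM('a) = 2 powr D * v powr D"
    proof (cases "v = 0")
      case False
      then have "sqrt (2 * v) ^ DIM('a) = ((2 * v) powr (1 / 2)) powr real DIM('a)"
        using True by (simp add: powr_half_sqrt powr_realpow)
      also have "\<dots> = 2 powr D * v powr D"
        using True by (simp add: powr_powr D_def powr_mult)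
      finally show ?thesis .
    qed (use D in auto)
    finally have L: "emeasure ?L {..v} = ennreal (K * (v powr D / D))"
      using D by (simp add: K_def mult_ac)
    have "((\<lambda>s. K * s powr (D - 1)) has_integral K * (v powr (D - 1 + 1) / (D - 1 + 1))) {0..v}"
      using D True by (intro has_integral_mult_right has_integral_powr_from_0) auto
    then have "integral\<^sup>N lborel (\<lambda>s. indicator {0..v} s * (K * s powr (D - 1))) = ennreal (K * (v powr D / D))"
      using K by (subst nn_integral_has_integral_lebesgue) auto
    moreover have "emeasure ?R {..v} = integral\<^sup>N lborel (\<lambda>s. indicator {0..v} s * (K * s powr (D - 1)))"
      unfolding R_eq by (intro nn_integral_cong) (auto simp: indicator_def)
    ultimately show ?thesis using L by simp
  qed
  show ?thesis
  proof (rule measure_eqI_generator_eq[where E = "range atMost" and \<Omega> = UNIV and A = "\<lambda>i. {..real i}"])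
    show "Int_stable (range atMost :: real set set)"
      by (auto simp: Int_stable_def)
    show "(\<Union>i. {..real i}) = UNIV"
      using real_arch_simple by auto
    show "sets ?L = sigma_sets UNIV (range atMost)" "sets ?R = sigma_sets UNIV (range atMost)"
      by (simp_all add: borel_eq_atMost)
    show "emeasure ?L V = emeasure ?R V" if "V \<in> range atMost" for V
      using that eq by blast
    show "emeasure ?L {..real i} \<noteq> \<infinity>" for i
      using eq by blast
  qed auto
qed

text \<open>
  In the variable \<open>v = (norm x)\<^sup>2 / 2\<close> the moment is a constant times \<open>Gamma ((DIM('a) + p) / 2)\<close>. The
  constant comes from the case \<open>p = 0\<close>, the total mass being one, and the volume of the unit ball cancels.
\<close>
lemma gaussian_moment:
  fixes p :: real
  assumes p: "p \<ge> 0"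
  shows "has_bochner_integral (gaussian :: 'a :: euclidean_space measure) (\<lambda>x. norm x powr p)
    (2 powr (p / 2) * Gamma ((real DIM('a) + p) / 2) / Gamma (real DIM('a) / 2))"
proof -
  define D where "D = real DIM('a) / 2"
  define K where "K = unit_ball_vol (real DIM('a)) * 2 powr D * D"
  define c where "c = (1 / sqrt (2 * pi)) ^ DIM('a)"
  have D: "D > 0" by (simp add: D_def)
  have K: "K \<ge> 0" using D by (simp add: K_def)
  have c: "c \<ge> 0" by (simp add: c_def)
  have moment: "(\<integral>\<^sup>+x. norm x powr s \<partial>(gaussian :: 'a measure))
      = ennreal (c * K * 2 powr (s / 2) * Gamma (D + s / 2))" if s: "s \<ge> 0" for s
  proof -
    let ?h = "\<lambda>v. ennreal (c * exp (- v) * (2 * v) powr (s / 2))"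
    have sqrt_powr: "(x\<^sup>2) powr (s / 2) = x powr s" if "x \<ge> 0" for x :: real
    proof (cases "x = 0")
      case False
      then have "x\<^sup>2 = x powr 2" using that powr_realpow[of x 2] by simp
      then show ?thesis by (simp only: powr_powr) simp
    qed simp
    have "(\<integral>\<^sup>+x. norm x powr s \<partial>(gaussian :: 'a measure))
        = (\<integral>\<^sup>+x. ?h ((norm x)\<^sup>2 / 2) \<partial>(lborel :: 'a measure))"
      unfolding gaussian_def gaussian_density_eq c_def[symmetric] using c
      by (subst nn_integral_density) (auto simp: ennreal_mult[symmetric] sqrt_powr)
    also have "\<dots> = (\<integral>\<^sup>+v. ?h v \<partial>distr (lborel :: 'a measure) borel (\<lambda>x. (norm x)\<^sup>2 / 2))"
      by (subst nn_integral_distr) auto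
    also have "\<dots> = (\<integral>\<^sup>+v. ennreal (K * (indicator {0..} v * v powr (D - 1))) * ?h v \<partial>lborel)"
      unfolding distr_lborel_half_norm_square D_def[symmetric] K_def[symmetric]
      by (subst nn_integral_density) auto
    also have "\<dots> = (\<integral>\<^sup>+v. ennreal (c * K * 2 powr (s / 2)) *
        ennreal (indicator {0..} v * v powr ((D + s / 2) - 1) / exp v) \<partial>lborel)"
    proof (intro nn_integral_cong)
      fix v :: real
      have "v powr (D - 1) * v powr (s / 2) = v powr ((D + s / 2) - 1)"
        by (simp add: algebra_simps flip: powr_add)
      then show "ennreal (K * (indicator {0..} v * v powr (D - 1))) * ?h v
          = ennreal (c * K * 2 powr (s / 2)) * ennreal (indicator {0..} v * v powr ((D + s / 2) - 1) / exp v)"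
        using c K by (simp add: ennreal_mult[symmetric] powr_mult exp_minus field_simps split: split_indicator)
    qed
    also have "\<dots> = ennreal (c * K * 2 powr (s / 2)) * ennreal (Gamma (D + s / 2))"
      using D s by (subst nn_integral_cmult) (auto simp: Gamma_conv_nn_integral_real)
    also have "\<dots> = ennreal (c * K * 2 powr (s / 2) * Gamma (D + s / 2))"
      using c K by (subst ennreal_mult') auto
    finally show ?thesis .
  qed
  have "(\<integral>\<^sup>+x. norm x powr 0 \<partial>(gaussian :: 'a measure)) = (\<integral>\<^sup>+x. 1 \<partial>(gaussian :: 'a measure))"
  proof (rule nn_integral_cong_AE)
    have "AE x in lborel. x \<noteq> (0 :: 'a)" by (rule AE_lborel_singleton)
    then have "AE x in lborel. 0 < ennreal (\<Prod>b\<in>Basis. std_normal_density (x \<bullet> b))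
        \<longrightarrow> ennreal (norm (x :: 'a) powr 0) = 1"
      by eventually_elim simp
    then show "AE x in (gaussian :: 'a measure). ennreal (norm x powr 0) = 1"
      unfolding gaussian_def by (subst AE_density) measurable
  qed
  also have "\<dots> = 1" using prob_space.emeasure_space_1[OF prob_space_gaussian] by simp
  finally have "ennreal (c * K * Gamma D) = 1" using moment[of 0] by simp
  then have "c * K * Gamma D = 1" by simp
  moreover have "Gamma D > 0" using D by (rule Gamma_real_pos)
  ultimately have cK: "c * K = 1 / Gamma D" by (simp add: field_simps)
  have "Gamma (D + p / 2) > 0" using D p by (intro Gamma_real_pos) auto
  have "(\<integral>\<^sup>+x. norm x powr p \<partial>(gaussian :: 'a measure)) = ennreal (2 powr (p / 2) * Gamma (D + p / 2) / Gamma D)"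
    unfolding moment[OF p] cK by (simp add: mult_ac)
  then have "has_bochner_integral (gaussian :: 'a measure) (\<lambda>x. norm x powr p)
      (2 powr (p / 2) * Gamma (D + p / 2) / Gamma D)"
    using \<open>Gamma D > 0\<close> \<open>Gamma (D + p / 2) > 0\<close>
    by (intro has_bochner_integral_nn_integral) auto
  then show ?thesis by (simp add: D_def add_divide_distrib)
qed

section \<open>Exponents and characteristic functions\<close>

lemma abs_sin_multiple_le: "\<bar>sin (real k * x)\<bar> \<le> real k * \<bar>sin x\<bar>"
proof (induction k)
  case (Suc k)
  have "\<bar>sin (real (Suc k) * x)\<bar> = \<bar>sin (real k * x) * cos x + cos (real k * x) * sin x\<bar>"
    by (simp only: of_nat_Suc distrib_right mult_1_left add.commute[of 1] sin_add)
  also have "\<dots> \<le> \<bar>sin (real k * x)\<bar> * \<bar>cos x\<bar> + \<bar>cos (real k * x)\<bar> * \<bar>sin x\<bar>"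
    by (metis abs_mult abs_triangle_ineq)
  also have "\<dots> \<le> \<bar>sin (real k * x)\<bar> * 1 + 1 * \<bar>sin x\<bar>"
    by (intro add_mono mult_mono) auto
  also have "\<dots> \<le> real (Suc k) * \<bar>sin x\<bar>"
    using Suc by (simp add: distrib_right)
  finally show ?case .
qed simp

lemma one_minus_cos_eq: "1 - cos x = 2 * (sin (x / 2))\<^sup>2" for x :: real
  using cos_double_sin[of "x / 2"] by simp

text \<open>
  This inequality and the next one are integrated below to inequalities between exponents. Both follow
  from \<open>1 - cos x = 2 (sin (x / 2))\<^sup>2\<close>.
\<close>
lemma one_minus_cos_multiple_le: "1 - cos (real k * x) \<le> (real k)\<^sup>2 * (1 - cos x)"
proof -
  have "(sin (real k * (x / 2)))\<^sup>2 \<le> (real k * \<bar>sin (x / 2)\<bar>)\<^sup>2"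
    using abs_sin_multiple_le[of k "x / 2"] by (metis abs_ge_zero power2_abs power_mono)
  then show ?thesis
    by (simp add: one_minus_cos_eq power_mult_distrib)
qed

lemma one_minus_cos_diff_le: "1 - cos (x - y) \<le> 2 * (1 - cos x) + 2 * (1 - cos y)" for x y :: real
proof -
  define a b where "a = sin (x / 2) * cos (y / 2)" and "b = cos (x / 2) * sin (y / 2)"
  have "(sin ((x - y) / 2))\<^sup>2 = (a - b)\<^sup>2"
    by (simp add: diff_divide_distrib sin_diff a_def b_def)
  also have "\<dots> \<le> 2 * a\<^sup>2 + 2 * b\<^sup>2"
    using zero_le_power2[of "a + b"] by (simp add: power2_sum power2_diff)
  also have "\<dots> \<le> 2 * ((sin (x / 2))\<^sup>2 * 1) + 2 * (1 * (sin (y / 2))\<^sup>2)"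
    unfolding a_def b_def power_mult_distrib
    by (intro add_mono mult_left_mono mult_mono) (auto simp: abs_square_le_1)
  finally show ?thesis by (simp add: one_minus_cos_eq)
qed

lemma one_minus_exp_over_tendsto:
  "((\<lambda>t. (1 - exp (- (t * c))) / t) \<longlongrightarrow> c) (at_right (0::real))"
proof -
  have "((\<lambda>t. 1 - exp (- (t * c))) has_real_derivative c) (at 0)"
    by (auto intro!: derivative_eq_intros)
  then have "((\<lambda>t. (1 - exp (- (t * c))) / t) \<longlongrightarrow> c) (at 0)"
    by (simp add: DERIV_def)
  then show ?thesis by (rule tendsto_mono[rotated]) (simp add: at_le)
qed

lemma integrable_cos_inner:
  fixes \<mu> :: "'a :: euclidean_space measure"
  assumes "prob_space \<mu>" and [measurable_cong]: "sets \<mu> = sets borel"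
  shows "integrable \<mu> (\<lambda>x. cos (\<xi> \<bullet> x))"
proof -
  interpret prob_space \<mu> by fact
  show ?thesis by (rule integrable_const_bound[where B = 1]) auto
qed

lemma Re_characteristic_function:
  fixes \<mu> :: "'a :: euclidean_space measure"
  assumes "prob_space \<mu>" and [measurable_cong]: "sets \<mu> = sets borel"
  shows "Re (CLINT x|\<mu>. iexp (\<xi> \<bullet> x)) = (\<integral>x. cos (\<xi> \<bullet> x) \<partial>\<mu>)"
proof -
  interpret prob_space \<mu> by fact
  have "integrable \<mu> (\<lambda>x. iexp (\<xi> \<bullet> x))"
    by (rule integrable_iexp[of "\<lambda>x. complex_of_real (\<xi> \<bullet> x)"]) auto
  then show ?thesis by (subst integral_Re[symmetric]) (auto simp: Re_exp)
qed

text \<open>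
  Since \<open>(1 - exp (- t \<psi> \<xi>)) / t\<close> tends to \<open>\<psi> \<xi>\<close> as \<open>t\<close> tends to zero and is an integral of
  \<open>1 - cos (\<xi> \<bullet> x)\<close> with nonnegative weight, inequalities for \<open>1 - cos\<close> pass to \<open>\<psi>\<close>. This takes the
  place of the Levy--Khintchine formula.
\<close>
lemma exponent_inequalities:
  fixes \<mu> :: "real \<Rightarrow> 'a :: euclidean_space measure" and \<psi> :: "'a \<Rightarrow> real"
  assumes prob: "\<And>t. t > 0 \<Longrightarrow> prob_space (\<mu> t)" and sets: "\<And>t. sets (\<mu> t) = sets borel"
    and cf: "\<And>t \<xi>. t > 0 \<Longrightarrow> (\<integral>x. cos (\<xi> \<bullet> x) \<partial>\<mu> t) = exp (- (t * \<psi> \<xi>))"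
  shows exponent_nonneg: "\<psi> \<xi> \<ge> 0"
    and exponent_diff_le: "\<psi> (\<xi> - \<zeta>) \<le> 2 * \<psi> \<xi> + 2 * \<psi> \<zeta>"
    and exponent_multiple_le: "\<psi> (real k *\<^sub>R \<xi>) \<le> (real k)\<^sup>2 * \<psi> \<xi>"
proof -
  have one_minus: "1 - exp (- (t * \<psi> \<xi>)) = (\<integral>x. 1 - cos (\<xi> \<bullet> x) \<partial>\<mu> t)"
    and int: "integrable (\<mu> t) (\<lambda>x. 1 - cos (\<xi> \<bullet> x))" if "t > 0" for t \<xi>
  proof -
    interpret prob_space "\<mu> t" using prob that .
    note i = integrable_cos_inner[OF prob[OF that] sets]
    show "integrable (\<mu> t) (\<lambda>x. 1 - cos (\<xi> \<bullet> x))" using i by simp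
    show "1 - exp (- (t * \<psi> \<xi>)) = (\<integral>x. 1 - cos (\<xi> \<bullet> x) \<partial>\<mu> t)"
      using i by (simp add: cf[OF that] prob_space)
  qed
  have ev: "eventually (\<lambda>t. t > 0) (at_right (0::real))"
    by (simp add: eventually_at_right_less)
  have "0 \<le> 1 - exp (- (1 * \<psi> \<xi>))"
    by (subst one_minus) auto
  then show "\<psi> \<xi> \<ge> 0" by simp
  show "\<psi> (\<xi> - \<zeta>) \<le> 2 * \<psi> \<xi> + 2 * \<psi> \<zeta>"
  proof (rule tendsto_le[OF trivial_limit_at_right_real])
    show "((\<lambda>t. (1 - exp (- (t * \<psi> (\<xi> - \<zeta>)))) / t) \<longlongrightarrow> \<psi> (\<xi> - \<zeta>)) (at_right 0)"
      by (rule one_minus_exp_over_tendsto)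
    show "((\<lambda>t. 2 * ((1 - exp (- (t * \<psi> \<xi>))) / t) + 2 * ((1 - exp (- (t * \<psi> \<zeta>))) / t))
        \<longlongrightarrow> 2 * \<psi> \<xi> + 2 * \<psi> \<zeta>) (at_right 0)"
      by (intro tendsto_intros one_minus_exp_over_tendsto)
    show "eventually (\<lambda>t. (1 - exp (- (t * \<psi> (\<xi> - \<zeta>)))) / t
        \<le> 2 * ((1 - exp (- (t * \<psi> \<xi>))) / t) + 2 * ((1 - exp (- (t * \<psi> \<zeta>))) / t)) (at_right 0)"
      using ev
    proof eventually_elim
      case (elim t)
      have "(\<integral>x. 1 - cos ((\<xi> - \<zeta>) \<bullet> x) \<partial>\<mu> t)
          \<le> (\<integral>x. 2 * (1 - cos (\<xi> \<bullet> x)) + 2 * (1 - cos (\<zeta> \<bullet> x)) \<partial>\<mu> t)"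
        by (rule integral_mono[OF int[OF elim]
              Bochner_Integration.integrable_add[OF integrable_mult_right[OF int[OF elim]] integrable_mult_right[OF int[OF elim]]]])
           (simp only: inner_diff_left one_minus_cos_diff_le)
      also have "\<dots> = 2 * (\<integral>x. 1 - cos (\<xi> \<bullet> x) \<partial>\<mu> t) + 2 * (\<integral>x. 1 - cos (\<zeta> \<bullet> x) \<partial>\<mu> t)"
        by (simp only: integral_mult_right_zero
              Bochner_Integration.integral_add[OF integrable_mult_right[OF int[OF elim]] integrable_mult_right[OF int[OF elim]]])
      finally show ?case
        using elim unfolding one_minus[OF elim] by (simp only: times_divide_eq_right add_divide_distrib[symmetric] divide_right_mono less_imp_le)
    qed
  qed
  show "\<psi> (real k *\<^sub>R \<xi>) \<le> (real k)\<^sup>2 * \<psi> \<xi>"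
  proof (rule tendsto_le[OF trivial_limit_at_right_real])
    show "((\<lambda>t. (1 - exp (- (t * \<psi> (real k *\<^sub>R \<xi>)))) / t) \<longlongrightarrow> \<psi> (real k *\<^sub>R \<xi>)) (at_right 0)"
      by (rule one_minus_exp_over_tendsto)
    show "((\<lambda>t. (real k)\<^sup>2 * ((1 - exp (- (t * \<psi> \<xi>))) / t)) \<longlongrightarrow> (real k)\<^sup>2 * \<psi> \<xi>) (at_right 0)"
      by (intro tendsto_intros one_minus_exp_over_tendsto)
    show "eventually (\<lambda>t. (1 - exp (- (t * \<psi> (real k *\<^sub>R \<xi>)))) / t
        \<le> (real k)\<^sup>2 * ((1 - exp (- (t * \<psi> \<xi>))) / t)) (at_right 0)"
      using ev
    proof eventually_elim
      case (elim t)
      have "(\<integral>x. 1 - cos ((real k *\<^sub>R \<xi>) \<bullet> x) \<partial>\<mu> t) \<le> (\<integral>x. (real k)\<^sup>2 * (1 - cos (\<xi> \<bullet> x)) \<partial>\<mu> t)"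
        by (rule integral_mono[OF int[OF elim] integrable_mult_right[OF int[OF elim]]])
           (simp only: inner_scaleR_left one_minus_cos_multiple_le)
      also have "\<dots> = (real k)\<^sup>2 * (\<integral>x. 1 - cos (\<xi> \<bullet> x) \<partial>\<mu> t)"
        by (rule integral_mult_right_zero)
      finally show ?case
        using elim unfolding one_minus[OF elim] by (simp only: times_divide_eq_right divide_right_mono less_imp_le)
    qed
  qed
qed

lemma continuous_on_exponent:
  fixes \<mu> :: "'a :: euclidean_space measure" and \<psi> :: "'a \<Rightarrow> real"
  assumes "prob_space \<mu>" and [measurable_cong]: "sets \<mu> = sets borel"
    and cf: "\<And>\<xi>. (\<integral>x. cos (\<xi> \<bullet> x) \<partial>\<mu>) = exp (- \<psi> \<xi>)"
  shows "continuous_on UNIV \<psi>"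
proof -
  interpret prob_space \<mu> by fact
  have "continuous_on UNIV (\<lambda>\<xi>. \<integral>x. cos (\<xi> \<bullet> x) \<partial>\<mu>)"
  proof (rule continuous_on_sequentiallyI)
    fix \<xi> :: "nat \<Rightarrow> 'a" and a assume lim: "\<xi> \<longlonglongrightarrow> a"
    show "(\<lambda>n. \<integral>x. cos (\<xi> n \<bullet> x) \<partial>\<mu>) \<longlonglongrightarrow> (\<integral>x. cos (a \<bullet> x) \<partial>\<mu>)"
      by (rule integral_dominated_convergence[where w = "\<lambda>_. 1"])
         (auto intro!: tendsto_intros lim)
  qed
  then have "continuous_on UNIV (\<lambda>\<xi>. - ln (\<integral>x. cos (\<xi> \<bullet> x) \<partial>\<mu>))"
    by (intro continuous_intros) (auto simp: cf)
  then show ?thesis by (simp add: cf)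
qed

text \<open>
  Two vectors of equal length are related by an orthogonal transformation, which preserves the law and
  hence its characteristic function.
\<close>
lemma exponent_radial:
  fixes \<mu> :: "(real ^ 'n) measure" and \<psi> :: "real ^ 'n \<Rightarrow> real"
  assumes inv: "rotation_invariant \<mu>" and [measurable_cong]: "sets \<mu> = sets borel"
    and cf: "\<And>\<xi>. (\<integral>x. cos (\<xi> \<bullet> x) \<partial>\<mu>) = exp (- \<psi> \<xi>)"
    and eq: "norm \<xi> = norm \<zeta>"
  shows "\<psi> \<xi> = \<psi> \<zeta>"
proof -
  obtain T where T: "orthogonal_transformation T" "T \<xi> = \<zeta>"
    using orthogonal_transformation_exists[OF eq] by blast
  have [measurable]: "T \<in> borel_measurable borel"
    using T(1) by (intro borel_measurable_continuous_onI linear_continuous_on)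
      (auto simp: orthogonal_transformation_def linear_conv_bounded_linear)
  have "(\<integral>x. cos (\<zeta> \<bullet> x) \<partial>\<mu>) = (\<integral>x. cos (\<zeta> \<bullet> x) \<partial>distr \<mu> borel T)"
    using inv T(1) by (simp add: rotation_invariant_def)
  also have "\<dots> = (\<integral>x. cos (T \<xi> \<bullet> T x) \<partial>\<mu>)"
    by (subst integral_distr) (auto simp: T(2))
  also have "\<dots> = (\<integral>x. cos (\<xi> \<bullet> x) \<partial>\<mu>)"
    using T(1) by (simp add: orthogonal_transformation_def)
  finally show ?thesis by (simp add: cf)
qed

text \<open>
  A Gaussian function is the average of the characters \<open>cos (\<xi> \<bullet> x)\<close> over a Gaussian vector \<open>\<xi>\<close>.
  Exchanging the integrals expresses the Laplace transform of \<open>(norm x)\<^sup>2\<close> under \<open>\<mu>\<close> by the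
  characteristic function of \<open>\<mu>\<close>, which turns the problem into a one-dimensional one.
\<close>
lemma laplace_transform_by_gaussian_average:
  fixes \<mu> :: "'a :: euclidean_space measure"
  assumes \<mu>: "prob_space \<mu>" and [measurable_cong]: "sets \<mu> = sets borel" and c: "c \<ge> 0"
  shows "(\<integral>x. 1 - exp (- (c * (norm x)\<^sup>2)) \<partial>\<mu>)
    = (\<integral>\<xi>. 1 - (\<integral>x. cos ((sqrt (2 * c) *\<^sub>R \<xi>) \<bullet> x) \<partial>\<mu>) \<partial>gaussian)"
proof -
  interpret \<mu>: prob_space \<mu> by fact
  interpret \<gamma>: prob_space "gaussian :: 'a measure" by (rule prob_space_gaussian)
  interpret P: pair_prob_space \<mu> "gaussian :: 'a measure" ..
  have "exp (- (c * (norm x)\<^sup>2)) = (\<integral>\<xi>. cos ((sqrt (2 * c) *\<^sub>R x) \<bullet> \<xi>) \<partial>gaussian)" for x :: 'a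
  proof -
    have "(\<integral>\<xi>. cos ((sqrt (2 * c) *\<^sub>R x) \<bullet> \<xi>) \<partial>gaussian) = exp (- (norm (sqrt (2 * c) *\<^sub>R x))\<^sup>2 / 2)"
      by (simp add: Re_characteristic_function[symmetric] prob_space_gaussian
          gaussian_characteristic_function del: inner_scaleR_left)
    then show ?thesis using c by (simp add: power_mult_distrib)
  qed
  then have "(\<integral>x. exp (- (c * (norm x)\<^sup>2)) \<partial>\<mu>)
      = (\<integral>x. (\<integral>\<xi>. cos ((sqrt (2 * c) *\<^sub>R \<xi>) \<bullet> x) \<partial>gaussian) \<partial>\<mu>)"
    by (simp add: inner_commute)
  also have "\<dots> = (\<integral>\<xi>. (\<integral>x. cos ((sqrt (2 * c) *\<^sub>R \<xi>) \<bullet> x) \<partial>\<mu>) \<partial>gaussian)"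
    by (rule P.Fubini_integral[symmetric], rule P.integrable_const_bound[where B = 1]) auto
  finally have eq: "(\<integral>x. exp (- (c * (norm x)\<^sup>2)) \<partial>\<mu>)
      = (\<integral>\<xi>. (\<integral>x. cos ((sqrt (2 * c) *\<^sub>R \<xi>) \<bullet> x) \<partial>\<mu>) \<partial>gaussian)" .
  have i1: "integrable \<mu> (\<lambda>x. exp (- (c * (norm x)\<^sup>2)))"
    by (rule \<mu>.integrable_const_bound[where B = 1]) (use c in auto)
  have "norm (\<integral>x. cos ((sqrt (2 * c) *\<^sub>R \<xi>) \<bullet> x) \<partial>\<mu>) \<le> 1" for \<xi>
    by (rule order_trans[OF integral_norm_bound])
       (auto intro!: \<mu>.integral_le_const \<mu>.integrable_const_bound[where B = 1] simp del: inner_scaleR_left)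
  then have i2: "integrable gaussian (\<lambda>\<xi> :: 'a. \<integral>x. cos ((sqrt (2 * c) *\<^sub>R \<xi>) \<bullet> x) \<partial>\<mu>)"
    by (intro \<gamma>.integrable_const_bound[where B = 1]) auto
  show ?thesis
    using i1 i2 eq by (simp add: \<mu>.prob_space \<gamma>.prob_space[simplified])
qed

text \<open>
  As \<open>u n\<close> tends to zero, \<open>1 - exp (- u n)\<close> may be replaced by \<open>u n\<close>. The sandwich
  \<open>u / (1 + u) \<le> 1 - exp (- u) \<le> u\<close> also covers indices with \<open>u n = 0\<close>.
\<close>
lemma scaled_one_minus_exp_tendsto:
  fixes u q :: "nat \<Rightarrow> real"
  assumes u: "\<And>n. u n \<ge> 0" and q: "\<And>n. q n > 0" "q \<longlonglongrightarrow> 0" and lim: "(\<lambda>n. u n / q n) \<longlonglongrightarrow> l"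
  shows "(\<lambda>n. (1 - exp (- u n)) / q n) \<longlonglongrightarrow> l"
proof (rule tendsto_sandwich)
  have "(\<lambda>n. q n * (u n / q n)) \<longlonglongrightarrow> 0 * l"
    by (intro tendsto_mult q lim)
  then have u0: "u \<longlonglongrightarrow> 0"
    using q(1) by (simp add: less_imp_neq[symmetric])
  have "(\<lambda>n. (u n / q n) / (1 + u n)) \<longlonglongrightarrow> l / (1 + 0)"
    by (intro tendsto_intros lim u0) auto
  then show "(\<lambda>n. (u n / q n) / (1 + u n)) \<longlonglongrightarrow> l" by simp
  show "eventually (\<lambda>n. (u n / q n) / (1 + u n) \<le> (1 - exp (- u n)) / q n) sequentially"
  proof (intro always_eventually allI)
    fix n
    have "exp (- u n) \<le> 1 / (1 + u n)"
      using u[of n] exp_ge_add_one_self[of "u n"] by (simp add: exp_minus field_simps)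
    then have "u n / (1 + u n) \<le> 1 - exp (- u n)"
      using u[of n] by (simp add: field_simps)
    from divide_right_mono[OF this less_imp_le[OF q(1)[of n]]]
    show "(u n / q n) / (1 + u n) \<le> (1 - exp (- u n)) / q n" by (simp add: mult.commute)
  qed
  show "eventually (\<lambda>n. (1 - exp (- u n)) / q n \<le> u n / q n) sequentially"
  proof (intro always_eventually allI divide_right_mono)
    fix n show "1 - exp (- u n) \<le> u n" using exp_ge_add_one_self[of "- u n"] by simp
  qed (use q in \<open>auto intro: less_imp_le\<close>)
qed (rule lim)

text \<open>
  After the preceding lemmas the quotient is a Gaussian average of
  \<open>(1 - exp (- t n f (\<rho> r n))) / (t n f (r n))\<close> with \<open>\<rho> = sqrt (2 c) norm \<xi>\<close>. Pointwise this tends to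
  \<open>\<rho> powr \<alpha>\<close> by regular variation, and it is dominated by the quadratic bound, which the Gaussian
  measure integrates. The limit is thus a Gaussian moment.
\<close>
lemma laplace_transform_limit:
  fixes \<mu> :: "nat \<Rightarrow> 'a :: euclidean_space measure" and f :: "real \<Rightarrow> real" and t r :: "nat \<Rightarrow> real"
  assumes \<mu>: "\<And>n. prob_space (\<mu> n)" and sets: "\<And>n. sets (\<mu> n) = sets borel"
    and cf: "\<And>n \<xi>. (\<integral>x. cos (\<xi> \<bullet> x) \<partial>\<mu> n) = exp (- (t n * f (norm \<xi>)))"
    and f_meas [measurable]: "f \<in> borel_measurable borel" and f_nonneg: "\<And>x. f x \<ge> 0"
    and t: "\<And>n. t n > 0" and r: "\<And>n. r n > 0" "filterlim r at_top sequentially"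
    and fr: "\<And>n. f (r n) > 0" and q: "(\<lambda>n. t n * f (r n)) \<longlonglongrightarrow> 0"
    and rv: "\<And>l. l > 0 \<Longrightarrow> ((\<lambda>x. f (l * x) / f x) \<longlongrightarrow> l powr \<alpha>) at_top"
    and bound: "\<And>n \<rho>. \<rho> \<ge> 0 \<Longrightarrow> f (\<rho> * r n) \<le> C * (1 + \<rho>\<^sup>2) * f (r n)"
    and \<alpha>: "\<alpha> \<ge> 0" and c: "c > 0"
  shows "(\<lambda>n. (\<integral>x. 1 - exp (- (c * (r n * norm x)\<^sup>2)) \<partial>\<mu> n) / (t n * f (r n)))
    \<longlonglongrightarrow> (2 powr \<alpha> * Gamma ((real DIM('a) + \<alpha>) / 2) / Gamma (real DIM('a) / 2)) * c powr (\<alpha> / 2)"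
proof -
  define s where "s = sqrt (2 * c)"
  have s: "s > 0" using c by (simp add: s_def)
  define q where "q = (\<lambda>n. t n * f (r n))"
  have q_pos: "q n > 0" for n using t fr by (simp add: q_def)
  define h where "h = (\<lambda>n (\<xi> :: 'a). (1 - exp (- (t n * f (s * norm \<xi> * r n)))) / q n)"
  have laplace_eq: "(\<integral>x. 1 - exp (- (c * (r n * norm x)\<^sup>2)) \<partial>\<mu> n) / q n = (\<integral>\<xi>. h n \<xi> \<partial>gaussian)" for n
  proof -
    have "sqrt (2 * (c * (r n)\<^sup>2)) = s * r n"
      using r(1)[of n] by (simp add: s_def real_sqrt_mult)
    then have "(\<integral>x. 1 - exp (- ((c * (r n)\<^sup>2) * (norm x)\<^sup>2)) \<partial>\<mu> n)
        = (\<integral>\<xi>. 1 - exp (- (t n * f (s * norm \<xi> * r n))) \<partial>(gaussian :: 'a measure))"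
      using laplace_transform_by_gaussian_average[OF \<mu> sets, of "c * (r n)\<^sup>2" n] c s r(1)[of n]
      by (simp add: cf abs_mult mult_ac del: inner_scaleR_left)
    then show ?thesis by (simp add: h_def power_mult_distrib mult_ac)
  qed
  have moment2: "integrable (gaussian :: 'a measure) (\<lambda>\<xi>. (norm \<xi>)\<^sup>2)"
    using gaussian_moment[of 2, where 'a = 'a] by (simp add: has_bochner_integral_iff)
  interpret \<gamma>: prob_space "gaussian :: 'a measure" by (rule prob_space_gaussian)
  have "(\<lambda>n. \<integral>\<xi>. h n \<xi> \<partial>gaussian) \<longlonglongrightarrow> (\<integral>\<xi>. (s * norm \<xi>) powr \<alpha> \<partial>(gaussian :: 'a measure))"
  proof (rule integral_dominated_convergence[where w = "\<lambda>\<xi>. C * (1 + (s * norm \<xi>)\<^sup>2)"])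
    show "integrable (gaussian :: 'a measure) (\<lambda>\<xi>. C * (1 + (s * norm \<xi>)\<^sup>2))"
      using moment2 by (simp add: power_mult_distrib)
    have "AE \<xi> in lborel. \<xi> \<noteq> (0 :: 'a)" by (rule AE_lborel_singleton)
    then have "AE \<xi> in (gaussian :: 'a measure). \<xi> \<noteq> 0"
      unfolding gaussian_def by (subst AE_density) (auto elim: eventually_mono)
    then show "AE \<xi> in (gaussian :: 'a measure). (\<lambda>n. h n \<xi>) \<longlonglongrightarrow> (s * norm \<xi>) powr \<alpha>"
    proof eventually_elim
      case (elim \<xi>)
      then have l: "s * norm \<xi> > 0" using s by simp
      have "(\<lambda>n. f (s * norm \<xi> * r n) / f (r n)) \<longlonglongrightarrow> (s * norm \<xi>) powr \<alpha>"
        by (rule filterlim_compose[OF rv[OF l] r(2)])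
      then have "(\<lambda>n. t n * f (s * norm \<xi> * r n) / q n) \<longlonglongrightarrow> (s * norm \<xi>) powr \<alpha>"
        using t by (simp add: q_def less_imp_neq[symmetric])
      then show ?case
        unfolding h_def using t f_nonneg q_pos q[folded q_def]
        by (intro scaled_one_minus_exp_tendsto) (auto intro: mult_nonneg_nonneg less_imp_le)
    qed
    show "AE \<xi> in (gaussian :: 'a measure). norm (h n \<xi>) \<le> C * (1 + (s * norm \<xi>)\<^sup>2)" for n
    proof (intro AE_I2)
      fix \<xi> :: 'a
      define u where "u = t n * f (s * norm \<xi> * r n)"
      have u: "u \<ge> 0" using t[of n] f_nonneg by (simp add: u_def)
      have "norm (h n \<xi>) = (1 - exp (- u)) / q n"
        using u q_pos[of n] by (simp add: h_def u_def)
      also have "\<dots> \<le> u / q n"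
        using exp_ge_add_one_self[of "- u"] q_pos[of n] by (intro divide_right_mono) auto
      also have "\<dots> \<le> (t n * (C * (1 + (s * norm \<xi>)\<^sup>2) * f (r n))) / q n"
        unfolding u_def using s t[of n] q_pos[of n]
        by (intro divide_right_mono mult_left_mono bound) auto
      also have "\<dots> = C * (1 + (s * norm \<xi>)\<^sup>2)"
        using t[of n] fr[of n] by (simp add: q_def)
      finally show "norm (h n \<xi>) \<le> C * (1 + (s * norm \<xi>)\<^sup>2)" .
    qed
  qed (auto simp: h_def)
  also have "(\<integral>\<xi>. (s * norm \<xi>) powr \<alpha> \<partial>(gaussian :: 'a measure))
      = s powr \<alpha> * (2 powr (\<alpha> / 2) * Gamma ((real DIM('a) + \<alpha>) / 2) / Gamma (real DIM('a) / 2))"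
    using gaussian_moment[OF \<alpha>, where 'a = 'a] s
    by (simp add: powr_mult has_bochner_integral_iff)
  also have "s powr \<alpha> = 2 powr (\<alpha> / 2) * c powr (\<alpha> / 2)"
    using c by (simp add: s_def powr_mult powr_powr flip: powr_half_sqrt)
  also have "2 powr (\<alpha> / 2) * c powr (\<alpha> / 2) *
        (2 powr (\<alpha> / 2) * Gamma ((real DIM('a) + \<alpha>) / 2) / Gamma (real DIM('a) / 2))
      = (2 powr (\<alpha> / 2) * 2 powr (\<alpha> / 2)) * Gamma ((real DIM('a) + \<alpha>) / 2) / Gamma (real DIM('a) / 2)
        * c powr (\<alpha> / 2)"
    by (simp only: mult_ac times_divide_eq_right times_divide_eq_left)
  also have "2 powr (\<alpha> / 2) * 2 powr (\<alpha> / 2) = (2 powr \<alpha> :: real)"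
    by (simp flip: powr_add)
  finally show ?thesis unfolding laplace_eq[symmetric] q_def .
qed

section \<open>The tail asymptotics of isotropic Levy processes\<close>

theorem theorem3:
  fixes M :: "'w measure"
    and X :: "real \<Rightarrow> 'w \<Rightarrow> real ^ 'n"
    and \<psi> :: "real ^ 'n \<Rightarrow> real"
    and \<alpha> :: real
  assumes "isotropic_levy_process M X"
    and "levy_khintchine_exponent M X \<psi>"
    and "0 \<le> \<alpha>" and "\<alpha> < 2"
    and "regularly_varying_at_top \<alpha> (radial_profile \<psi>)"
  shows "\<forall>\<epsilon>>0. \<exists>\<delta>>0. \<forall>t>0. \<forall>r\<ge>1 / \<delta>. t * radial_profile \<psi> r \<le> \<delta> \<longrightarrow>
           \<bar>\<P>(\<omega> in M. norm (X t \<omega>) \<ge> 1 / r) / (t * radial_profile \<psi> r)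
             - tail_constant CARD('n) \<alpha>\<bar> < \<epsilon>"
proof -
  interpret isotropic_levy_process M X by fact
  define \<mu> where "\<mu> t = distr M borel (X t)" for t
  have \<mu>_prob: "prob_space (\<mu> t)" if "t > 0" for t
    unfolding \<mu>_def using that by (intro prob_space_distr measurable_at) simp
  have \<mu>_sets [simp]: "sets (\<mu> t) = sets borel" for t
    by (simp add: \<mu>_def)
  have cf: "(\<integral>x. cos (\<xi> \<bullet> x) \<partial>\<mu> t) = exp (- (t * \<psi> \<xi>))" if "t > 0" for t \<xi>
  proof -
    have "(CLINT x|\<mu> t. iexp (\<xi> \<bullet> x)) = exp (- complex_of_real (t * \<psi> \<xi>))"
      using assms(2) that by (simp add: levy_khintchine_exponent_def \<mu>_def)
    then have "(\<integral>x. cos (\<xi> \<bullet> x) \<partial>\<mu> t) = Re (exp (- complex_of_real (t * \<psi> \<xi>)))"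
      using Re_characteristic_function[OF \<mu>_prob[OF that] \<mu>_sets, of \<xi>] by simp
    also have "\<dots> = exp (- (t * \<psi> \<xi>))" by (simp add: Re_exp)
    finally show ?thesis .
  qed
  note \<psi>_nonneg = exponent_nonneg[of \<mu> \<psi>, OF \<mu>_prob \<mu>_sets cf]
    and \<psi>_diff = exponent_diff_le[of \<mu> \<psi>, OF \<mu>_prob \<mu>_sets cf]
    and \<psi>_multiple = exponent_multiple_le[of \<mu> \<psi>, OF \<mu>_prob \<mu>_sets cf]
  have \<psi>_cont: "continuous_on UNIV \<psi>"
    by (rule continuous_on_exponent[OF \<mu>_prob[of 1] \<mu>_sets]) (use cf[of 1] in auto)
  have \<psi>_radial: "\<psi> \<xi> = \<psi> \<zeta>" if "norm \<xi> = norm \<zeta>" for \<xi> \<zeta>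
    by (rule exponent_radial[of "\<mu> 1", OF _ \<mu>_sets _ that])
       (use isotropic[of 1] cf[of 1] in \<open>auto simp: \<mu>_def\<close>)
  obtain e :: "real ^ 'n" where e: "norm e = 1"
    using vector_choose_size[of 1] by auto
  \<comment> \<open>On the line through \<open>e\<close> the profile extends to an even function on the reals, for which the
    inequalities of \<open>\<psi>\<close> make sense for all differences.\<close>
  define f where "f x = \<psi> (x *\<^sub>R e)" for x
  have \<psi>_f: "\<psi> \<xi> = f (norm \<xi>)" for \<xi>
    unfolding f_def by (rule \<psi>_radial) (simp add: e)
  have profile: "radial_profile \<psi> r = f r" if "r \<ge> 0" for r
    unfolding radial_profile_def
  proof (rule the_equality)
    show "\<forall>\<xi>. norm \<xi> = r \<longrightarrow> \<psi> \<xi> = f r" by (simp add: \<psi>_f)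
    show "y = f r" if "\<forall>\<xi>. norm \<xi> = r \<longrightarrow> \<psi> \<xi> = y" for y
      using that[rule_format, of "r *\<^sub>R e"] \<open>r \<ge> 0\<close> by (simp add: e f_def)
  qed
  obtain x\<^sub>0 where x\<^sub>0: "x\<^sub>0 > 0" "\<And>x. x \<ge> x\<^sub>0 \<Longrightarrow> f x > 0"
    using assms(5) profile unfolding regularly_varying_at_top_def
    by (metis less_imp_le order_less_le_trans)
  have rv: "((\<lambda>x. f (l * x) / f x) \<longlongrightarrow> l powr \<alpha>) at_top" if "l > 0" for l
  proof (rule Lim_transform_eventually)
    show "((\<lambda>x. radial_profile \<psi> (l * x) / radial_profile \<psi> x) \<longlongrightarrow> l powr \<alpha>) at_top"
      using assms(5) that by (simp add: regularly_varying_at_top_def)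
    show "eventually (\<lambda>x. radial_profile \<psi> (l * x) / radial_profile \<psi> x = f (l * x) / f x) at_top"
      using eventually_ge_at_top[of 0] by eventually_elim (use that in \<open>simp add: profile\<close>)
  qed
  have f_cont: "continuous_on UNIV f"
    unfolding f_def by (intro continuous_on_compose2[OF \<psi>_cont] continuous_intros) auto
  have f_diff: "f (x - y) \<le> 2 * f x + 2 * f y" for x y
    unfolding f_def scaleR_diff_left by (rule \<psi>_diff)
  have f_multiple: "f (real k * x) \<le> (real k)\<^sup>2 * f x" for k x
    unfolding f_def scaleR_scaleR[symmetric] by (rule \<psi>_multiple)
  obtain C R where CR: "C > 0" "\<And>r \<rho>. r \<ge> R \<Longrightarrow> \<rho> \<ge> 0 \<Longrightarrow> f (\<rho> * r) \<le> C * (1 + \<rho>\<^sup>2) * f r"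
    by (rule regularly_varying_quadratic_bound[of f x\<^sub>0 \<alpha>, rotated 5])
       (rule that f_cont x\<^sub>0(2) rv f_diff f_multiple; assumption)+
  define B where "B = max x\<^sub>0 R"
  have B: "B > 0" using x\<^sub>0 by (simp add: B_def)
  \<comment> \<open>If the claim fails, there are sequences along which the quotient stays away from the constant;
    this reduces the joint limit to limits of sequences.\<close>
  define close where "close \<epsilon> t r \<longleftrightarrow>
      \<bar>\<P>(\<omega> in M. norm (X t \<omega>) \<ge> 1 / r) / (t * radial_profile \<psi> r) - tail_constant CARD('n) \<alpha>\<bar> < \<epsilon>"
    for \<epsilon> t r :: real
  show ?thesis
    unfolding close_def[symmetric]
  proof (intro allI impI, rule ccontr)
    fix \<epsilon> :: real
    assume \<epsilon>: "\<epsilon> > 0"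
      and no: "\<not> (\<exists>\<delta>>0. \<forall>t>0. \<forall>r\<ge>1 / \<delta>. t * radial_profile \<psi> r \<le> \<delta> \<longrightarrow> close \<epsilon> t r)"
    \<comment> \<open>Adding \<open>B\<close> keeps \<open>r n\<close> in the range where the profile is positive and the quadratic bound holds.\<close>
    define \<delta> where "\<delta> n = 1 / (real (Suc n) + B)" for n
    have "\<delta> n > 0" for n using B by (simp add: \<delta>_def)
    with no have "\<exists>t r. t > 0 \<and> r \<ge> 1 / \<delta> n \<and> t * radial_profile \<psi> r \<le> \<delta> n \<and> \<not> close \<epsilon> t r" for n
      by blast
    then obtain t r where tr: "\<And>n. t n > 0" "\<And>n. r n \<ge> 1 / \<delta> n"
      "\<And>n. t n * radial_profile \<psi> (r n) \<le> \<delta> n" "\<And>n. \<not> close \<epsilon> (t n) (r n)"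
      by metis
    have r_ge: "r n \<ge> real (Suc n) + B" for n
      using tr(2)[of n] by (simp add: \<delta>_def)
    have r_pos: "r n > 0" and r_B: "r n \<ge> B" for n using r_ge[of n] B by auto
    have r_top: "filterlim r at_top sequentially"
      by (rule filterlim_at_top_mono[OF filterlim_real_sequentially])
         (use r_ge B in \<open>auto intro!: always_eventually order_trans[OF _ r_ge]\<close>)
    have fr: "f (r n) > 0" for n using x\<^sub>0(2)[of "r n"] r_B[of n] by (simp add: B_def)
    have prof: "radial_profile \<psi> (r n) = f (r n)" for n
      using r_pos[of n] by (intro profile) simp
    have q_pos: "t n * f (r n) > 0" for n using tr(1) fr by simp
    have q_lim: "(\<lambda>n. t n * f (r n)) \<longlonglongrightarrow> 0"
    proof (rule tendsto_sandwich[OF _ _ tendsto_const LIMSEQ_inverse_real_of_nat])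
      show "eventually (\<lambda>n. t n * f (r n) \<le> inverse (real (Suc n))) sequentially"
      proof (intro always_eventually allI)
        fix n
        have "t n * f (r n) \<le> \<delta> n" using tr(3)[of n] by (simp add: prof)
        also have "\<dots> \<le> inverse (real (Suc n))"
          unfolding \<delta>_def inverse_eq_divide using B by (intro divide_left_mono) auto
        finally show "t n * f (r n) \<le> inverse (real (Suc n))" .
      qed
    qed (use q_pos in \<open>auto intro!: always_eventually less_imp_le\<close>)
    define \<kappa> where "\<kappa> = 2 powr \<alpha> * Gamma ((real CARD('n) + \<alpha>) / 2) / Gamma (real CARD('n) / 2)"
    define Z where "Z n x = (r n * norm x)\<^sup>2" for n and x :: "real ^ 'n"
    have tail: "(\<lambda>n. measure (\<mu> (t n)) {x \<in> space (\<mu> (t n)). Z n x \<ge> 1} / (t n * f (r n)))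
        \<longlonglongrightarrow> \<kappa> / Gamma (1 - \<alpha> / 2)"
    proof (rule tauberian_tail)
      show "(\<lambda>n. (\<integral>x. 1 - exp (- (real (Suc i) * Z n x)) \<partial>\<mu> (t n)) / (t n * f (r n)))
          \<longlonglongrightarrow> \<kappa> * real (Suc i) powr (\<alpha> / 2)" for i
        unfolding Z_def \<kappa>_def
      proof (rule laplace_transform_limit[where 'a = "real ^ 'n", simplified DIM_cart DIM_real mult_1_right,
            where C = C and f = f])
        show "(\<integral>x. cos (\<xi> \<bullet> x) \<partial>\<mu> (t n)) = exp (- (t n * f (norm \<xi>)))" for n \<xi>
          using cf[OF tr(1)] by (simp add: \<psi>_f)
        show "f \<in> borel_measurable borel"
          by (rule borel_measurable_continuous_onI[OF f_cont])
        show "f x \<ge> 0" for x unfolding f_def by (rule \<psi>_nonneg)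
        show "f (\<rho> * r n) \<le> C * (1 + \<rho>\<^sup>2) * f (r n)" if "\<rho> \<ge> 0" for n \<rho>
          using CR(2)[OF _ that, of "r n"] r_B[of n] by (simp add: B_def)
      qed (use \<mu>_prob tr(1) r_pos r_top fr q_lim rv assms(3) in auto)
    qed (use \<mu>_prob tr(1) q_pos assms(3,4) in \<open>auto simp: Z_def cong: measurable_cong_sets\<close>)
    have prob_eq: "measure (\<mu> (t n)) {x \<in> space (\<mu> (t n)). Z n x \<ge> 1}
        = \<P>(\<omega> in M. norm (X (t n) \<omega>) \<ge> 1 / r n)" for n
    proof -
      have [measurable]: "X (t n) \<in> borel_measurable M" using tr(1)[of n] by (intro measurable_at) simp
      have "Z n x \<ge> 1 \<longleftrightarrow> norm x \<ge> 1 / r n" for x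
      proof -
        have "1 \<le> (r n * norm x)\<^sup>2 \<longleftrightarrow> 1 \<le> r n * norm x"
          using r_pos[of n] abs_le_square_iff[of 1 "r n * norm x"] by (simp add: abs_mult)
        then show ?thesis
          using r_pos[of n] by (simp add: Z_def divide_le_eq mult.commute)
      qed
      then show ?thesis
        unfolding \<mu>_def by (subst measure_distr) (auto simp: Z_def intro!: arg_cong[where f = prob])
    qed
    have "tail_constant CARD('n) \<alpha> = \<kappa> / Gamma (1 - \<alpha> / 2)"
      by (simp add: tail_constant_def \<kappa>_def)
    with tail have "(\<lambda>n. \<P>(\<omega> in M. norm (X (t n) \<omega>) \<ge> 1 / r n) / (t n * radial_profile \<psi> (r n)))
        \<longlonglongrightarrow> tail_constant CARD('n) \<alpha>"
      by (simp add: prob_eq prof)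
    from LIMSEQ_D[OF this \<epsilon>] obtain n where "close \<epsilon> (t n) (r n)"
      by (auto simp: close_def)
    with tr(4) show False by blast
  qed
qed

end
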